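(* Fix ordinals $\alpha, \beta < \omega_1$. Then for any $\boldsymbol{\Sigma}^0_{\alpha + 1}$-measurable function $f \colon 2^{\mathbb{N}} \rightarrow 2^{\mathbb{N}}$ and any set $A\subseteq 2^{\mathbb{N}}$ which is $\boldsymbol{\Sigma}^0_{\alpha + \beta}$-complete or $\boldsymbol{\Pi}^0_{\alpha + \beta}$-complete, there exists a closed set $C \subseteq 2^{\mathbb{N}}$ such that $f|_C$ is continuous and $A \cap C$ is $\boldsymbol{\Sigma}^0_\beta$-hard or $\boldsymbol{\Pi}^0_\beta$-hard.
   Context: $2^{\mathbb{N}}$ has the product topology. A set $S\subseteq 2^{\mathbb{N}}$ is $\boldsymbol{\Sigma}^0_0$ (equivalently $\boldsymbol{\Pi}^0_0$) if it is clopen. For $1\le\alpha<\omega_1$, a set is $\boldsymbol{\Sigma}^0_\alpha$ (resp. $\boldsymbol{\Pi}^0_\alpha$) if it is a countable union (resp. intersection) of sets $S_n$, $n\in\mathbb{N}$, each of which is $\boldsymbol{\Pi}^0_{\beta_n}$ (resp. $\boldsymbol{\Sigma}^0_{\beta_n}$) for some $\beta_n<\alpha$ (for $\alpha\geq 1$ this is the usual Borel hierarchy). A function $f\colon 2^{\mathbb{N}}\to 2^{\mathbb{N}}$ is $\boldsymbol{\Sigma}^0_\alpha$-measurable if $f^{-1}(U)\in\boldsymbol{\Sigma}^0_\alpha$ for every open $U$. For a class $\mathcal{C}\subseteq\mathcal{P}(2^{\mathbb{N}})$, a set $S\subseteq 2^{\mathbb{N}}$ is $\mathcal{C}$-hard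 if for every $S'\in\mathcal{C}$ there is a continuous map $\varphi\colon 2^{\mathbb{N}}\to 2^{\mathbb{N}}$ with $x\in S'\iff\varphi(x)\in S$; it is $\mathcal{C}$-complete if it is $\mathcal{C}$-hard and belongs to $\mathcal{C}$. *)

theory Defs
  imports "HOL-Analysis.Analysis"
begin

section \<open>Countable ordinals\<close>

text \<open>The ordinals below \<open>\<omega>\<^sub>1\<close> are the order types of the well-orders whose field is a
  (finite or infinite) set of natural numbers.  The partial equivalence \<^const>\<open>ordIso\<close>
  already requires both relations to be well-orders of their fields.\<close>

quotient_type countable_ordinal = "nat rel" / partial: "\<lambda>r s. (r, s) \<in> ordIso"
proof (rule part_equivpI)
  show "\<exists>r :: nat rel. (r, r) \<in> ordIso"
    by (intro exI[of _ "{}"] ordIso_reflexive) simp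
  show "symp (\<lambda>r s :: nat rel. (r, s) \<in> ordIso)"
    by (rule sympI) (rule ordIso_symmetric)
  show "transp (\<lambda>r s :: nat rel. (r, s) \<in> ordIso)"
    by (rule transpI) (rule ordIso_transitive)
qed

lemma ordIso_refl_iff: "(r, r) \<in> ordIso \<longleftrightarrow> Well_order r"
  by (metis ordIso_reflexive ordIso_iff_ordLeq ordLeq_Well_order_simp)

lemma ordIsoD:
  assumes "(r, s) \<in> ordIso"
  shows "Well_order r" "Well_order s"
  using assms unfolding ordIso_def by simp_all

lemma ordIsoI:
  assumes "Well_order r" "Well_order s" "bij_betw f (Field r) (Field s)"
    "\<And>a b. (a, b) \<in> r \<Longrightarrow> (f a, f b) \<in> s"
  shows "(r, s) \<in> ordIso"
proof -
  have "iso r s f"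
    using assms(4) by (simp add: iso_iff3[OF assms(1,2)] assms(3) compat_def)
  then show ?thesis
    unfolding ordIso_def using assms(1,2) by blast
qed

text \<open>\<open>rel_sum r s\<close> is \<open>r\<close> followed by \<open>s\<close>, with \<open>r\<close> moved to the even and \<open>s\<close> to the odd numbers.\<close>

definition rel_sum :: "nat rel \<Rightarrow> nat rel \<Rightarrow> nat rel" where
  "rel_sum r s =
     {(2 * m, 2 * n) | m n. (m, n) \<in> r} \<union>
     {(2 * m + 1, 2 * n + 1) | m n. (m, n) \<in> s} \<union>
     {(2 * m, 2 * n + 1) | m n. m \<in> Field r \<and> n \<in> Field s}"

lemma rel_sum_iff:
  "(a, b) \<in> rel_sum r s \<longleftrightarrow>
     (if even a
      then (if even b then (a div 2, b div 2) \<in> r else a div 2 \<in> Field r \<and> b div 2 \<in> Field s)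
      else odd b \<and> (a div 2, b div 2) \<in> s)"
proof -
  have *: "(\<exists>m. x = 2 * m \<and> P m) \<longleftrightarrow> even x \<and> P (x div 2)"
    "(\<exists>m. x = 2 * m + 1 \<and> P m) \<longleftrightarrow> odd x \<and> P (x div 2)" for x :: nat and P
    by (metis dvd_triv_left dvd_mult_div_cancel nonzero_mult_div_cancel_left zero_neq_numeral)
      (metis odd_two_times_div_two_succ even_mult_iff even_plus_one_iff even_numeral
         div_mult_self1_is_m even_succ_div_two nonzero_mult_div_cancel_left zero_neq_numeral)
  have "(a, b) \<in> rel_sum r s \<longleftrightarrow>
      (\<exists>m. a = 2 * m \<and> (\<exists>n. b = 2 * n \<and> (m, n) \<in> r)) \<or>
      (\<exists>m. a = 2 * m + 1 \<and> (\<exists>n. b = 2 * n + 1 \<and> (m, n) \<in> s)) \<or>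
      (\<exists>m. a = 2 * m \<and> (\<exists>n. b = 2 * n + 1 \<and> m \<in> Field r \<and> n \<in> Field s))"
    unfolding rel_sum_def by blast
  then show ?thesis
    unfolding * by auto
qed

lemma Field_rel_sum_iff:
  "a \<in> Field (rel_sum r s) \<longleftrightarrow> (if even a then a div 2 \<in> Field r else a div 2 \<in> Field s)"
proof
  assume "a \<in> Field (rel_sum r s)"
  then obtain b where "(a, b) \<in> rel_sum r s \<or> (b, a) \<in> rel_sum r s"
    by (auto simp: Field_def)
  then show "if even a then a div 2 \<in> Field r else a div 2 \<in> Field s"
    by (auto simp: rel_sum_iff split: if_splits intro: FieldI1 FieldI2)
next
  assume *: "if even a then a div 2 \<in> Field r else a div 2 \<in> Field s"
  show "a \<in> Field (rel_sum r s)"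
  proof (cases "even a")
    case True
    with * obtain n where "(a div 2, n) \<in> r \<or> (n, a div 2) \<in> r"
      by (auto simp: Field_def)
    with True have "(a, 2 * n) \<in> rel_sum r s \<or> (2 * n, a) \<in> rel_sum r s"
      by (simp add: rel_sum_iff)
    then show ?thesis
      by (auto intro: FieldI1 FieldI2)
  next
    case False
    with * obtain n where "(a div 2, n) \<in> s \<or> (n, a div 2) \<in> s"
      by (auto simp: Field_def)
    with False have "(a, 2 * n + 1) \<in> rel_sum r s \<or> (2 * n + 1, a) \<in> rel_sum r s"
      by (simp add: rel_sum_iff)
    then show ?thesis
      by (auto intro: FieldI1 FieldI2)
  qed
qed

lemma Well_order_rel_sum:
  assumes "Well_order r" "Well_order s"
  shows "Well_order (rel_sum r s)"
proof -
  have half: "x = y" if "even x = even y" "x div 2 = y div 2" for x y :: nat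
    using that by presburger
  have r: "\<And>a. a \<in> Field r \<Longrightarrow> (a, a) \<in> r" "\<And>a b c. (a, b) \<in> r \<Longrightarrow> (b, c) \<in> r \<Longrightarrow> (a, c) \<in> r"
    "\<And>a b. (a, b) \<in> r \<Longrightarrow> (b, a) \<in> r \<Longrightarrow> a = b"
    "\<And>a b. a \<in> Field r \<Longrightarrow> b \<in> Field r \<Longrightarrow> (a, b) \<in> r \<or> (b, a) \<in> r"
    and s: "\<And>a. a \<in> Field s \<Longrightarrow> (a, a) \<in> s" "\<And>a b c. (a, b) \<in> s \<Longrightarrow> (b, c) \<in> s \<Longrightarrow> (a, c) \<in> s"
    "\<And>a b. (a, b) \<in> s \<Longrightarrow> (b, a) \<in> s \<Longrightarrow> a = b"
    "\<And>a b. a \<in> Field s \<Longrightarrow> b \<in> Field s \<Longrightarrow> (a, b) \<in> s \<or> (b, a) \<in> s"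
    and wf: "wf (r - Id)" "wf (s - Id)"
    using assms unfolding order_on_defs refl_on_def trans_def antisym_def total_on_def by metis+
  have "Refl (rel_sum r s)"
    unfolding refl_on_def by (simp add: Field_rel_sum_iff rel_sum_iff r s)
  moreover have "trans (rel_sum r s)"
    unfolding trans_def rel_sum_iff
    by (auto split: if_splits intro: FieldI1 FieldI2 r(2) s(2))
  moreover have "antisym (rel_sum r s)"
    unfolding antisym_def rel_sum_iff
    by (metis half r(3) s(3))
  moreover have "Total (rel_sum r s)"
    unfolding total_on_def Ball_def Field_rel_sum_iff rel_sum_iff
    using r(4) s(4) by (auto split: if_splits)
  moreover have "wf (rel_sum r s - Id)"
  proof (rule wfI_min)
    fix x :: nat and Q
    assume "x \<in> Q"
    show "\<exists>z\<in>Q. \<forall>y. (y, z) \<in> rel_sum r s - Id \<longrightarrow> y \<notin> Q"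
    proof (cases "\<exists>m. 2 * m \<in> Q")
      case True
      then obtain m where "m \<in> {m. 2 * m \<in> Q}"
        by blast
      then obtain z where "z \<in> {m. 2 * m \<in> Q}" "\<And>y. (y, z) \<in> r - Id \<Longrightarrow> y \<notin> {m. 2 * m \<in> Q}"
        by (rule wfE_min[OF wf(1)]) blast
      then have z: "2 * z \<in> Q" "\<And>y. (y, z) \<in> r - Id \<Longrightarrow> 2 * y \<notin> Q"
        by simp_all
      have "y \<notin> Q" if "(y, 2 * z) \<in> rel_sum r s - Id" for y
        using that z(2)[of "y div 2"] by (auto simp: rel_sum_iff split: if_splits)
      with z(1) show ?thesis
        by blast
    next
      case False
      then have odd: "odd y" if "y \<in> Q" for y
        using that by (auto elim: evenE)
      then have "x div 2 \<in> {m. 2 * m + 1 \<in> Q}"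
        using \<open>x \<in> Q\<close> by simp
      then obtain z where "z \<in> {m. 2 * m + 1 \<in> Q}" "\<And>y. (y, z) \<in> s - Id \<Longrightarrow> y \<notin> {m. 2 * m + 1 \<in> Q}"
        by (rule wfE_min[OF wf(2)]) blast
      then have z: "2 * z + 1 \<in> Q" "\<And>y. (y, z) \<in> s - Id \<Longrightarrow> 2 * y + 1 \<notin> Q"
        by simp_all
      have "y \<notin> Q" if "(y, 2 * z + 1) \<in> rel_sum r s - Id" for y
        using that z(2)[of "y div 2"] odd by (auto simp: rel_sum_iff split: if_splits elim!: oddE)
      with z(1) show ?thesis
        by blast
    qed
  qed
  ultimately show ?thesis
    unfolding order_on_defs by (auto intro: FieldI1 FieldI2)
qed

lemma rel_sum_cong:
  assumes "(r, r') \<in> ordIso" "(s, s') \<in> ordIso"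
  shows "(rel_sum r s, rel_sum r' s') \<in> ordIso"
proof -
  note wo = assms[THEN ordIsoD(1)] assms[THEN ordIsoD(2)]
  obtain f g where "iso r r' f" "iso s s' g"
    using assms unfolding ordIso_def by blast
  then have bij: "bij_betw f (Field r) (Field r')" "bij_betw g (Field s) (Field s')"
    and compat: "\<And>a b. (a, b) \<in> r \<Longrightarrow> (f a, f b) \<in> r'" "\<And>a b. (a, b) \<in> s \<Longrightarrow> (g a, g b) \<in> s'"
    using wo by (simp_all add: iso_iff3 compat_def)
  define h where "h n = (if even n then 2 * f (n div 2) else 2 * g (n div 2) + 1)" for n
  define k where "k n = (if even n then 2 * inv_into (Field r) f (n div 2)
    else 2 * inv_into (Field s) g (n div 2) + 1)" for n
  note * = bij[THEN bij_betw_inv_into_left] bij[THEN bij_betw_inv_into_right]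
    bij[THEN bij_betw_apply] bij[THEN bij_betw_inv_into, THEN bij_betw_apply]
  show ?thesis
  proof (rule ordIsoI)
    show "bij_betw h (Field (rel_sum r s)) (Field (rel_sum r' s'))"
      by (rule bij_betw_byWitness[where f' = k])
        (auto simp: h_def k_def Field_rel_sum_iff * split: if_splits)
    show "(h a, h b) \<in> rel_sum r' s'" if "(a, b) \<in> rel_sum r s" for a b
      using that by (auto simp: h_def rel_sum_iff compat * split: if_splits)
  qed (simp_all add: wo Well_order_rel_sum)
qed

lemma rel_sum_assoc:
  assumes "Well_order r" "Well_order s" "Well_order t"
  shows "(rel_sum (rel_sum r s) t, rel_sum r (rel_sum s t)) \<in> ordIso"
proof -
  define h :: "nat \<Rightarrow> nat" where
    "h n = (if odd n then 2 * n + 1 else if odd (n div 2) then n - 1 else n div 2)" for n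
  define k :: "nat \<Rightarrow> nat" where
    "k n = (if even n then 2 * n else if even (n div 2) then n + 1 else n div 2)" for n
  have kh: "k (h n) = n" and hk: "h (k n) = n" for n
    unfolding h_def k_def by presburger+
  have h: "even (h n) \<longleftrightarrow> even n \<and> even (n div 2)"
    "even (h n div 2) \<longleftrightarrow> (if even n then if even (n div 2) then even (n div 4) else True else False)"
    for n
    unfolding h_def by presburger+
  have h': "even n \<Longrightarrow> even (n div 2) \<Longrightarrow> h n div 2 = n div 2 div 2"
    "even n \<Longrightarrow> odd (n div 2) \<Longrightarrow> h n div 2 div 2 = n div 2 div 2"
    "odd n \<Longrightarrow> h n div 2 div 2 = n div 2"
    "even n \<Longrightarrow> odd (n div 2) \<Longrightarrow> even (h n div 2)"
    "odd n \<Longrightarrow> odd (h n div 2)" for n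
    unfolding h_def by presburger+
  have F: "h a \<in> Field (rel_sum r (rel_sum s t)) \<longleftrightarrow> a \<in> Field (rel_sum (rel_sum r s) t)" for a
    by (auto simp: Field_rel_sum_iff h(1) h')
  show ?thesis
  proof (rule ordIsoI)
    show "bij_betw h (Field (rel_sum (rel_sum r s) t)) (Field (rel_sum r (rel_sum s t)))"
      by (rule bij_betw_byWitness[where f' = k])
        (auto simp: kh hk F F[of "k _", unfolded hk, symmetric])
    show "(h a, h b) \<in> rel_sum r (rel_sum s t)" if "(a, b) \<in> rel_sum (rel_sum r s) t" for a b
      using that
      by (cases "even a"; cases "even b"; cases "even (a div 2)"; cases "even (b div 2)";
          simp add: rel_sum_iff Field_rel_sum_iff h(1) h')
  qed (simp_all add: assms Well_order_rel_sum)
qed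

instantiation countable_ordinal :: wellorder
begin

lift_definition less_eq_countable_ordinal :: "countable_ordinal \<Rightarrow> countable_ordinal \<Rightarrow> bool"
  is "\<lambda>r s. (r, s) \<in> ordLeq"
  using ordIso_ordLeq_trans ordLeq_ordIso_trans ordIso_symmetric by blast

lift_definition less_countable_ordinal :: "countable_ordinal \<Rightarrow> countable_ordinal \<Rightarrow> bool"
  is "\<lambda>r s. (r, s) \<in> ordLess"
  using ordIso_ordLess_trans ordLess_ordIso_trans ordIso_symmetric by blast

instance
proof
  fix x y z :: countable_ordinal
  show "x < y \<longleftrightarrow> x \<le> y \<and> \<not> y \<le> x"
    by transfer (metis ordIsoD(1) not_ordLeq_iff_ordLess ordLess_imp_ordLeq)
  show "x \<le> x"
    by transfer (rule ordIso_imp_ordLeq)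
  show "x \<le> y \<Longrightarrow> y \<le> z \<Longrightarrow> x \<le> z"
    by transfer (rule ordLeq_transitive)
  show "x \<le> y \<Longrightarrow> y \<le> x \<Longrightarrow> x = y"
    by transfer (simp add: ordIso_iff_ordLeq)
  show "x \<le> y \<or> y \<le> x"
    by transfer (metis ordLeq_total ordIsoD(1))
next
  fix P :: "countable_ordinal \<Rightarrow> bool" and x
  assume step: "\<And>x. (\<And>y. y < x \<Longrightarrow> P y) \<Longrightarrow> P x"
  have "wf (inv_image ordLess rep_countable_ordinal)"
    by (intro wf_inv_image wf_ordLess)
  then show "P x"
  proof (induction x rule: wf_induct_rule)
    case (less x)
    show ?case
    proof (rule step)
      fix y assume "y < x"
      then show "P y"
        using less by (simp add: less_countable_ordinal.rep_eq)
    qed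
  qed
qed

end

instantiation countable_ordinal :: "{monoid_add, zero_neq_one}"
begin

lift_definition zero_countable_ordinal :: countable_ordinal is "{}"
  by (simp add: ordIso_refl_iff)

lift_definition one_countable_ordinal :: countable_ordinal is "{(0, 0)}"
  by (auto simp: ordIso_refl_iff Field_def order_on_defs refl_on_def trans_def antisym_def
      total_on_def)

lift_definition plus_countable_ordinal ::
    "countable_ordinal \<Rightarrow> countable_ordinal \<Rightarrow> countable_ordinal"
  is rel_sum
  by (rule rel_sum_cong)

instance
proof
  fix x y z :: countable_ordinal
  show "x + y + z = x + (y + z)"
    by transfer (simp add: ordIso_refl_iff rel_sum_assoc)
  show "0 + x = x"
  proof transfer
    fix r :: "nat rel" assume "(r, r) \<in> ordIso"
    then have "Well_order r"
      by (simp add: ordIso_refl_iff)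
    show "(rel_sum {} r, r) \<in> ordIso"
    proof (rule ordIsoI)
      show "bij_betw (\<lambda>n. n div 2) (Field (rel_sum {} r)) (Field r)"
        by (rule bij_betw_byWitness[where f' = "\<lambda>n. 2 * n + 1"])
          (auto simp: Field_rel_sum_iff split: if_splits)
    qed (use \<open>Well_order r\<close> in \<open>auto simp: Well_order_rel_sum rel_sum_iff split: if_splits\<close>)
  qed
  show "x + 0 = x"
  proof transfer
    fix r :: "nat rel" assume "(r, r) \<in> ordIso"
    then have "Well_order r"
      by (simp add: ordIso_refl_iff)
    show "(rel_sum r {}, r) \<in> ordIso"
    proof (rule ordIsoI)
      show "bij_betw (\<lambda>n. n div 2) (Field (rel_sum r {})) (Field r)"
        by (rule bij_betw_byWitness[where f' = "\<lambda>n. 2 * n"])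
          (auto simp: Field_rel_sum_iff split: if_splits)
    qed (use \<open>Well_order r\<close> in \<open>auto simp: Well_order_rel_sum rel_sum_iff split: if_splits\<close>)
  qed
  show "(0 :: countable_ordinal) \<noteq> 1"
    by transfer (auto simp: ordIso_def iso_def bij_betw_def Field_def)
qed

end

lemma zero_le_countable_ordinal [simp]: "(0 :: countable_ordinal) \<le> \<alpha>"
  by transfer (auto simp: ordIso_refl_iff ordLeq_def embed_def)

lemma countable_ordinal_less_one_iff: "\<alpha> < (1 :: countable_ordinal) \<longleftrightarrow> \<alpha> = 0"
proof
  show "\<alpha> = 0" if "\<alpha> < 1"
    using that
  proof transfer
    fix r :: "nat rel"
    assume "(r, {(0 :: nat, 0 :: nat)}) \<in> ordLess"
    moreover from this have "Well_order r" "Well_order {(0 :: nat, 0 :: nat)}"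
      by (simp_all add: ordLess_def)
    ultimately obtain a where "a \<in> Field {(0 :: nat, 0 :: nat)}"
        "(r, Restr {(0 :: nat, 0 :: nat)} (underS {(0, 0)} a)) \<in> ordIso"
      by (auto simp: ordLess_iff_ordIso_Restr)
    moreover from this have "underS {(0 :: nat, 0 :: nat)} a = {}"
      by (auto simp: underS_def Field_def)
    ultimately show "(r, {} :: nat rel) \<in> ordIso"
      by simp
  qed
  show "\<alpha> < 1" if "\<alpha> = 0"
    using that by (simp add: order_less_le)
qed
lemma countable_ordinal_one_le_iff: "(1 :: countable_ordinal) \<le> \<alpha> \<longleftrightarrow> \<alpha> \<noteq> 0"
  using countable_ordinal_less_one_iff[of \<alpha>] by (auto simp: not_less[symmetric])


section \<open>The Borel hierarchy on the Cantor space\<close>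

type_synonym cantor = "nat \<Rightarrow> bool"

inductive is_Sigma0 is_Pi0 :: "countable_ordinal \<Rightarrow> cantor set \<Rightarrow> bool" where
  Sigma0_clopen: "open S \<Longrightarrow> closed S \<Longrightarrow> is_Sigma0 0 S"
| Pi0_clopen: "open S \<Longrightarrow> closed S \<Longrightarrow> is_Pi0 0 S"
| Sigma0_Union: "1 \<le> \<alpha> \<Longrightarrow> (\<And>n::nat. \<exists>\<beta><\<alpha>. is_Pi0 \<beta> (S n)) \<Longrightarrow> is_Sigma0 \<alpha> (\<Union>n. S n)"
| Pi0_Inter: "1 \<le> \<alpha> \<Longrightarrow> (\<And>n::nat. \<exists>\<beta><\<alpha>. is_Sigma0 \<beta> (S n)) \<Longrightarrow> is_Pi0 \<alpha> (\<Inter>n. S n)"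

definition Sigma0 :: "countable_ordinal \<Rightarrow> cantor set set" where
  "Sigma0 \<alpha> = {S. is_Sigma0 \<alpha> S}"

definition Pi0 :: "countable_ordinal \<Rightarrow> cantor set set" where
  "Pi0 \<alpha> = {S. is_Pi0 \<alpha> S}"

lemma Sigma0_0: "Sigma0 0 = {S. open S \<and> closed S}" and Pi0_0: "Pi0 0 = {S. open S \<and> closed S}"
  by (auto simp: Sigma0_def Pi0_def is_Sigma0.simps[of 0] is_Pi0.simps[of 0] countable_ordinal_one_le_iff)

lemma Sigma0_iff:
  assumes "1 \<le> \<alpha>"
  shows "S \<in> Sigma0 \<alpha> \<longleftrightarrow> (\<exists>T :: nat \<Rightarrow> cantor set. S = (\<Union>n. T n) \<and> (\<forall>n. \<exists>\<beta><\<alpha>. T n \<in> Pi0 \<beta>))"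
  using assms
  by (auto simp: Sigma0_def Pi0_def is_Sigma0.simps[of \<alpha>] countable_ordinal_one_le_iff)

lemma Pi0_iff:
  assumes "1 \<le> \<alpha>"
  shows "S \<in> Pi0 \<alpha> \<longleftrightarrow> (\<exists>T :: nat \<Rightarrow> cantor set. S = (\<Inter>n. T n) \<and> (\<forall>n. \<exists>\<beta><\<alpha>. T n \<in> Sigma0 \<beta>))"
  using assms
  by (auto simp: Sigma0_def Pi0_def is_Pi0.simps[of \<alpha>] countable_ordinal_one_le_iff)

definition Sigma0_measurable :: "countable_ordinal \<Rightarrow> (cantor \<Rightarrow> cantor) \<Rightarrow> bool" where
  "Sigma0_measurable \<alpha> f \<longleftrightarrow> (\<forall>U. open U \<longrightarrow> f -` U \<in> Sigma0 \<alpha>)"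

definition hard_for :: "cantor set set \<Rightarrow> cantor set \<Rightarrow> bool" where
  "hard_for \<C> S \<longleftrightarrow>
     (\<forall>S'\<in>\<C>. \<exists>\<phi> :: cantor \<Rightarrow> cantor. continuous_on UNIV \<phi> \<and> (\<forall>x. x \<in> S' \<longleftrightarrow> \<phi> x \<in> S))"

definition complete_for :: "cantor set set \<Rightarrow> cantor set \<Rightarrow> bool" where
  "complete_for \<C> S \<longleftrightarrow> hard_for \<C> S \<and> S \<in> \<C>"

end

theory Submission
  imports Defs "HOL-Library.Sublist"
begin

text \<open>
  It suffices to find a continuous \<open>p\<close> for which \<open>f \<circ> p\<close> is continuous and the preimage of \<open>A\<close> is
  hard for the class at level \<open>\<beta>\<close>: the range of \<open>p\<close> is compact, \<open>f\<close> is continuous on it, and \<open>p\<close>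
  reduces the preimage to the intersection of \<open>A\<close> with the range.

  The map \<open>p\<close> comes from a form of jump inversion (\<open>jump_inversion\<close>).  There is a
  \<open>\<Sigma>\<close>-measurable map \<open>h\<close> of level \<open>\<alpha> + 1\<close>, depending only on \<open>\<alpha>\<close>, such that for every
  sequence of sets \<open>F i\<close> of class \<open>\<Sigma>\<close> at level \<open>\<alpha>\<close> some continuous section \<open>\<phi>\<close> of \<open>h\<close> makes all the sets
  \<open>\<phi> -` F i\<close> clopen.  Suppose \<open>A\<close> is \<open>\<Sigma>\<close>-complete at level \<open>\<alpha> + \<beta>\<close> with \<open>\<beta> \<ge> 1\<close>, and let \<open>T\<close> be
  \<open>\<Sigma>\<close>-complete at level \<open>\<beta>\<close>.  Then \<open>h -` T\<close> is \<open>\<Sigma>\<close> at level \<open>\<alpha> + \<beta>\<close>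
  (\<open>Sigma0_measurable_vimage\<close>), so some continuous \<open>\<psi>\<close> reduces it to \<open>A\<close>.  The preimages of basic
  clopen sets under \<open>f \<circ> \<psi>\<close> are unions of countably many \<open>\<Pi>\<close> sets of level \<open>\<alpha>\<close>; if \<open>\<phi>\<close> makes all of
  these clopen, then \<open>f \<circ> \<psi> \<circ> \<phi>\<close> is continuous and \<open>p = \<psi> \<circ> \<phi>\<close> reduces \<open>T\<close> to \<open>A\<close>.
  The \<open>\<Pi>\<close> case takes the complement of \<open>T\<close>, and \<open>\<beta> = 0\<close> needs only a one-point set \<open>C\<close>.

  For \<open>\<alpha> = 0\<close> the identity serves as \<open>h\<close>; for \<open>\<alpha> \<ge> 1\<close>, jump inversion is Friedberg's argument
  with Cohen forcing.  A point is read as a pair \<open>(e, x)\<close>,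
  where \<open>e\<close> codes the sequence \<open>F\<close> through a universal set (\<open>universal_Sigma0_exists\<close>).  Given \<open>y\<close>, the
  point \<open>x\<close> is built by alternately extending a finite condition so that it decides the next
  subcode of the \<open>F i\<close> and appending the next bit of \<open>y\<close>.  Since \<open>x\<close> decides everything, forcing
  equals truth (\<open>forcing_truth\<close>), and membership in \<open>F i\<close> is settled after finitely many bits of
  \<open>y\<close>.  Conversely \<open>h\<close> recovers \<open>y\<close> from \<open>(e, x)\<close> by repeating the construction, and its level is
  \<open>\<alpha> + 1\<close> because forcing a set of level \<open>\<alpha>\<close> is itself a condition of level \<open>\<alpha>\<close> on \<open>e\<close>
  (\<open>forces_refutes_rank\<close>).
\<close>

section \<open>Arithmetic of countable ordinals\<close>

text \<open>This moves an initial segment between a summand and its copy inside a sum.\<close>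

lemma ordIso_Restr_image:
  fixes r s :: "nat rel"
  assumes "Well_order r" "Well_order s" "inj_on g B" "B \<subseteq> Field r" "g ` B \<subseteq> Field s"
    and mono: "\<And>a b. a \<in> B \<Longrightarrow> b \<in> B \<Longrightarrow> (a, b) \<in> r \<Longrightarrow> (g a, g b) \<in> s"
  shows "(Restr r B, Restr s (g ` B)) \<in> ordIso"
proof (rule ordIsoI)
  have *: "Field (Restr r B) = B" "Field (Restr s (g ` B)) = g ` B"
    using assms by (auto simp: order_on_defs Refl_Field_Restr2)
  show "bij_betw g (Field (Restr r B)) (Field (Restr s (g ` B)))"
    using assms(3) unfolding * by (simp add: bij_betw_def)
  show "(g a, g b) \<in> Restr s (g ` B)" if "(a, b) \<in> Restr r B" for a b
    using that mono by auto
qed (use assms in \<open>auto intro: Well_order_Restr\<close>)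

lemma less_countable_ordinal_alt:
  fixes \<alpha> \<beta> :: countable_ordinal
  assumes "\<beta> < \<alpha>"
  obtains a where "a \<in> Field (rep_countable_ordinal \<alpha>)"
    "\<beta> = abs_countable_ordinal
       (Restr (rep_countable_ordinal \<alpha>) (underS (rep_countable_ordinal \<alpha>) a))"
proof -
  let ?rep = rep_countable_ordinal
  have "(?rep \<beta>, ?rep \<alpha>) \<in> ordLess"
    using assms by (simp add: less_countable_ordinal.rep_eq)
  moreover from this have "Well_order (?rep \<beta>)" "Well_order (?rep \<alpha>)"
    by (auto simp: ordLess_def)
  ultimately obtain a where a: "a \<in> Field (?rep \<alpha>)"
      "(?rep \<beta>, Restr (?rep \<alpha>) (underS (?rep \<alpha>) a)) \<in> ordIso"
    by (auto simp: ordLess_iff_ordIso_Restr)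
  from a(2) have "abs_countable_ordinal (?rep \<beta>) =
      abs_countable_ordinal (Restr (?rep \<alpha>) (underS (?rep \<alpha>) a))"
    using Quotient3_rel[OF Quotient3_countable_ordinal] ordIsoD[OF a(2)] by (auto simp: ordIso_refl_iff)
  then show ?thesis
    using that a(1) by (simp add: Quotient3_abs_rep[OF Quotient3_countable_ordinal])
qed

text \<open>The smaller ordinals are the order types of the initial segments of one well-order
  of natural numbers, and each segment is given by a natural number.\<close>

lemma countable_lessThan_countable_ordinal: "countable {..<\<alpha> :: countable_ordinal}"
proof -
  let ?r = "rep_countable_ordinal \<alpha>"
  have "{..<\<alpha>} \<subseteq> (\<lambda>a. abs_countable_ordinal (Restr ?r (underS ?r a))) ` UNIV"
    by (auto elim!: less_countable_ordinal_alt)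
  then show ?thesis
    by (rule countable_subset) simp
qed

lemma add_strict_left_mono_countable_ordinal:
  fixes \<alpha> \<beta> \<gamma> :: countable_ordinal
  assumes "\<beta> < \<gamma>"
  shows "\<alpha> + \<beta> < \<alpha> + \<gamma>"
  using assms
proof transfer
  fix r s t :: "nat rel"
  assume "(r, r) \<in> ordIso" "(s, t) \<in> ordLess"
  then have wo: "Well_order r" "Well_order s" "Well_order t"
    by (auto simp: ordIso_refl_iff ordLess_def)
  with \<open>(s, t) \<in> ordLess\<close> obtain a where a: "a \<in> Field t" "(s, Restr t (underS t a)) \<in> ordIso"
    by (auto simp: ordLess_iff_ordIso_Restr)
  \<comment> \<open>The sum of \<open>r\<close> with the segment of \<open>t\<close> below \<open>a\<close> is the segment of the sum below the copy
    \<open>2 * a + 1\<close> of \<open>a\<close>.\<close>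
  have "(rel_sum r s, rel_sum r (Restr t (underS t a))) \<in> ordIso"
    using a wo by (intro rel_sum_cong) (auto simp: ordIso_refl_iff)
  moreover have "Field (Restr t (underS t a)) = underS t a"
    using wo by (intro Refl_Field_Restr2) (auto simp: order_on_defs underS_Field)
  then have "rel_sum r (Restr t (underS t a)) =
      Restr (rel_sum r t) (underS (rel_sum r t) (2 * a + 1))"
  proof (intro set_eqI, clarify)
    fix x y :: nat
    assume F: "Field (Restr t (underS t a)) = underS t a"
    have parity: "2 * m \<noteq> Suc (2 * n)" for m n :: nat
      by presburger
    consider m n where "x = 2 * m" "y = 2 * n" | m n where "x = 2 * m" "y = 2 * n + 1"
      | m n where "x = 2 * m + 1" "y = 2 * n" | m n where "x = 2 * m + 1" "y = 2 * n + 1"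
      by (metis evenE oddE)
    then show "(x, y) \<in> rel_sum r (Restr t (underS t a)) \<longleftrightarrow>
      (x, y) \<in> Restr (rel_sum r t) (underS (rel_sum r t) (2 * a + 1))"
    proof cases
      case 1
      then show ?thesis
        using a(1) by (auto simp: rel_sum_iff underS_def parity intro: FieldI1 FieldI2)
    next
      case 2
      then show ?thesis
        using a(1) F by (auto simp: rel_sum_iff underS_def parity intro: FieldI1 FieldI2)
    qed (auto simp: rel_sum_iff underS_def)
  qed
  ultimately show "(rel_sum r s, rel_sum r t) \<in> ordLess"
    using wo a by (auto simp: ordLess_iff_ordIso_Restr Well_order_rel_sum Field_rel_sum_iff
        intro!: bexI[of _ "2 * a + 1"])
qed

lemma less_add_one_countable_ordinal_iff:
  fixes \<alpha> \<beta> :: countable_ordinal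
  shows "\<beta> < \<alpha> + 1 \<longleftrightarrow> \<beta> \<le> \<alpha>"
proof
  show "\<beta> \<le> \<alpha>" if "\<beta> < \<alpha> + 1"
    using that
  proof transfer
    fix r s :: "nat rel"
    let ?o = "{(0::nat, 0::nat)}"
    assume "(r, r) \<in> ordIso" "(s, rel_sum r ?o) \<in> ordLess"
    then have wo: "Well_order r" "Well_order s" "Well_order (rel_sum r ?o)"
      by (auto simp: ordIso_refl_iff ordLess_def)
    with \<open>(s, rel_sum r ?o) \<in> ordLess\<close> obtain a where a: "a \<in> Field (rel_sum r ?o)"
        "(s, Restr (rel_sum r ?o) (underS (rel_sum r ?o) a)) \<in> ordIso"
      by (auto simp: ordLess_iff_ordIso_Restr)
    \<comment> \<open>The segment omits the only odd element, which is the top, so it lives on the copy of \<open>r\<close>.\<close>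
    define B where "B = {m. 2 * m \<in> underS (rel_sum r ?o) a}"
    have "B \<subseteq> Field r"
      by (auto simp: B_def underS_def rel_sum_iff split: if_splits intro: FieldI1)
    have "underS (rel_sum r ?o) a \<subseteq> (*) 2 ` B"
    proof
      fix x assume x: "x \<in> underS (rel_sum r ?o) a"
      have "even x"
        using x a(1) 
        by (auto simp: underS_def rel_sum_iff Field_rel_sum_iff Field_def split: if_splits elim!: oddE)
      with x show "x \<in> (*) 2 ` B"
        by (auto simp: B_def elim!: evenE)
    qed
    then have "underS (rel_sum r ?o) a = (*) 2 ` B"
      by (auto simp: B_def)
    moreover have "(Restr r B, Restr (rel_sum r ?o) ((*) 2 ` B)) \<in> ordIso"
      using wo \<open>B \<subseteq> Field r\<close>
      by (intro ordIso_Restr_image) (auto simp: inj_on_def Field_rel_sum_iff rel_sum_iff)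
    moreover have "(Restr r B, r) \<in> ordLeq"
    proof -
      interpret wo_rel r
        using wo by (simp add: wo_rel_def)
      have "ofilter B"
        using \<open>B \<subseteq> Field r\<close> wo(3) a(1) unfolding ofilter_def
      proof (intro conjI subsetI ballI)
        fix m m' assume m: "m \<in> B" "m' \<in> Order_Relation.under r m"
        then have "(2 * m', 2 * m) \<in> rel_sum r ?o" "(2 * m, a) \<in> rel_sum r ?o" "2 * m \<noteq> a"
          by (auto simp: B_def underS_def under_def rel_sum_iff)
        then have "(2 * m', a) \<in> rel_sum r ?o" "2 * m' \<noteq> a"
          using wo(3) unfolding order_on_defs trans_def antisym_def by metis+
        then show "m' \<in> B"
          by (simp add: B_def underS_def)
      qed auto
      then have "(Restr r B, Restr r (Field r)) \<in> ordLeq"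
        using ofilter_subset_ordLeq[OF WELL _ Field_ofilter] \<open>B \<subseteq> Field r\<close> by blast
      then show ?thesis
        by (simp add: Restr_Field)
    qed
    ultimately show "(s, r) \<in> ordLeq"
      using a(2) by (metis ordIso_symmetric ordIso_ordLeq_trans)
  qed
  have "\<alpha> + 0 < \<alpha> + 1"
    by (intro add_strict_left_mono_countable_ordinal) (simp add: countable_ordinal_less_one_iff)
  then show "\<beta> < \<alpha> + 1" if "\<beta> \<le> \<alpha>"
    using that by simp
qed

lemma one_le_add_one: "(1 :: countable_ordinal) \<le> \<alpha> + 1"
proof -
  have "0 < \<alpha> + (1 :: countable_ordinal)"
    by (simp add: less_add_one_countable_ordinal_iff)
  then show ?thesis
    by (auto simp: countable_ordinal_one_le_iff)
qed

section \<open>The topology of the Cantor space\<close>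

definition agree :: "nat \<Rightarrow> cantor \<Rightarrow> cantor \<Rightarrow> bool" where
  "agree n x y \<longleftrightarrow> (\<forall>i<n. x i = y i)"

lemma agree_refl [simp]: "agree n x x"
  by (simp add: agree_def)

lemma agree_trans: "agree n x y \<Longrightarrow> agree n y z \<Longrightarrow> agree n x z"
  by (simp add: agree_def)

lemma agree_mono: "agree n x y \<Longrightarrow> m \<le> n \<Longrightarrow> agree m x y"
  by (simp add: agree_def)

lemma open_agree: "open {y. agree n x y}"
proof -
  have "{y. agree n x y} = (\<Inter>i\<in>{..<n}. (\<lambda>y. y i) -` {x i})"
    by (auto simp: agree_def)
  moreover have "open ((\<lambda>y. y i) -` {x i})" for i
    by (rule open_vimage) (simp_all add: open_discrete)
  ultimately show ?thesis
    by (simp add: open_INT)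
qed

lemma open_cantor_iff: "open (U :: cantor set) \<longleftrightarrow> (\<forall>x\<in>U. \<exists>n. \<forall>y. agree n x y \<longrightarrow> y \<in> U)"
proof
  assume U: "open U"
  show "\<forall>x\<in>U. \<exists>n. \<forall>y. agree n x y \<longrightarrow> y \<in> U"
  proof
    fix x assume "x \<in> U"
    with U obtain X where X: "x \<in> Pi\<^sub>E UNIV X" "finite {i. X i \<noteq> UNIV}" "Pi\<^sub>E UNIV X \<subseteq> U"
      using product_topology_open_contains_basis[of "\<lambda>_. euclidean" UNIV U x]
      unfolding open_fun_def by auto
    from X(2) obtain n where n: "{i. X i \<noteq> UNIV} \<subseteq> {..<n}"
      using finite_nat_iff_bounded by blast
    have "y \<in> U" if "agree n x y" for y
    proof -
      have "y i \<in> X i" for i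
      proof (cases "X i = UNIV")
      case False
      with n have "x i = y i"
        using that by (auto simp: agree_def)
      moreover have "x i \<in> X i"
        using X(1) by auto
      ultimately show ?thesis
        by simp
    qed simp
      then show ?thesis
        using X(3) by auto
    qed
    then show "\<exists>n. \<forall>y. agree n x y \<longrightarrow> y \<in> U"
      by blast
  qed
next
  assume *: "\<forall>x\<in>U. \<exists>n. \<forall>y. agree n x y \<longrightarrow> y \<in> U"
  show "open U"
  proof (subst open_subopen, rule ballI)
    fix x assume "x \<in> U"
    with * obtain n where "\<forall>y. agree n x y \<longrightarrow> y \<in> U"
      by blast
    then show "\<exists>T. open T \<and> x \<in> T \<and> T \<subseteq> U"
      by (intro exI[of _ "{y. agree n x y}"]) (auto simp: open_agree)
  qed
qed

lemma compact_UNIV_cantor: "compact (UNIV :: cantor set)"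
proof -
  have "compact_space (product_topology (\<lambda>_::nat. euclidean :: bool topology) UNIV)"
    unfolding compact_space_product_topology
    by (simp add: compact_space_def finite_imp_compact)
  then show ?thesis
    unfolding euclidean_product_topology by (simp add: compact_space_def)
qed

lemma compact_imp_closed_cantor:
  assumes "compact (K :: cantor set)"
  shows "closed K"
proof -
  have "Hausdorff_space (euclidean :: bool topology)"
    unfolding Hausdorff_space_def
  proof (intro allI impI)
    fix a b :: bool assume "a \<in> topspace euclidean \<and> b \<in> topspace euclidean \<and> a \<noteq> b"
    then show "\<exists>U V. openin euclidean U \<and> openin euclidean V \<and> a \<in> U \<and> b \<in> V \<and> disjnt U V"
      by (intro exI[of _ "{a}"] exI[of _ "{b}"]) (simp add: open_discrete)
  qed
  then have "Hausdorff_space (euclidean :: cantor topology)"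
    using Hausdorff_space_product_topology[of "\<lambda>_. euclidean :: bool topology" "UNIV :: nat set"]
    by (simp flip: euclidean_product_topology)
  then have "closedin euclidean K"
    using assms by (intro compactin_imp_closedin) auto
  then show ?thesis
    by simp
qed

text \<open>Membership in a clopen set depends locally on finitely many coordinates; compactness makes
  their number uniform.\<close>

lemma clopen_cantor_iff:
  "open S \<and> closed S \<longleftrightarrow> (\<exists>n. \<forall>x y :: cantor. agree n x y \<longrightarrow> (x \<in> S \<longleftrightarrow> y \<in> S))"
proof
  assume S: "open S \<and> closed S"
  then have "open S" "open (- S)"
    by (simp_all add: open_closed)
  then have "\<exists>n. \<forall>y. agree n x y \<longrightarrow> (x \<in> S \<longleftrightarrow> y \<in> S)" for x
    unfolding open_cantor_iff by (metis ComplD ComplI)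
  then obtain N where N: "\<And>x y. agree (N x) x y \<Longrightarrow> (x \<in> S \<longleftrightarrow> y \<in> S)"
    by metis
  have "UNIV \<subseteq> (\<Union>x. {y. agree (N x) x y})"
    by auto
  then obtain D where D: "finite D" "UNIV \<subseteq> (\<Union>x\<in>D. {y. agree (N x) x y})"
    using compactE_image[OF compact_UNIV_cantor open_agree, of N "\<lambda>x. x" UNIV] by auto
  define n where "n = Max (insert 0 (N ` D))"
  have "x \<in> S \<longleftrightarrow> y \<in> S" if "agree n x y" for x y
  proof -
    from D(2) obtain z where z: "z \<in> D" "agree (N z) z x"
      by blast
    moreover have "N z \<le> n"
      using D(1) z(1) by (auto simp: n_def)
    ultimately have "agree (N z) z y"
      using that by (meson agree_trans agree_mono)
    with z(2) show ?thesis
      using N by metis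
  qed
  then show "\<exists>n. \<forall>x y. agree n x y \<longrightarrow> (x \<in> S \<longleftrightarrow> y \<in> S)"
    by blast
next
  assume "\<exists>n. \<forall>x y. agree n x y \<longrightarrow> (x \<in> S \<longleftrightarrow> y \<in> S)"
  then obtain n where n: "\<And>x y. agree n x y \<Longrightarrow> x \<in> S \<longleftrightarrow> y \<in> S"
    by blast
  have "open S" "open (- S)"
    unfolding open_cantor_iff using n by (metis, metis ComplD ComplI)
  then show "open S \<and> closed S"
    by (simp add: closed_def)
qed

lemma continuous_cantorI:
  fixes \<phi> :: "cantor \<Rightarrow> cantor"
  assumes "\<And>x k. \<exists>n. \<forall>y. agree n x y \<longrightarrow> \<phi> y k = \<phi> x k"
  shows "continuous_on UNIV \<phi>"
proof (rule continuous_on_coordinatewise_then_product)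
  fix k
  show "continuous_on UNIV (\<lambda>x. \<phi> x k)"
    unfolding continuous_on_open_vimage[OF open_UNIV]
  proof (intro allI impI)
    fix B :: "bool set"
    show "open ((\<lambda>x. \<phi> x k) -` B \<inter> UNIV)"
      unfolding open_cantor_iff
    proof
      fix x assume x: "x \<in> (\<lambda>x. \<phi> x k) -` B \<inter> UNIV"
      obtain n where n: "\<forall>y. agree n x y \<longrightarrow> \<phi> y k = \<phi> x k"
        using assms[of x k] by (elim exE)
      have "y \<in> (\<lambda>x. \<phi> x k) -` B \<inter> UNIV" if "agree n x y" for y
      proof -
        have "\<phi> y k = \<phi> x k"
          using n that by (elim allE impE)
        with x show ?thesis
          by simp
      qed
      then show "\<exists>n. \<forall>y. agree n x y \<longrightarrow> y \<in> (\<lambda>x. \<phi> x k) -` B \<inter> UNIV"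
        by (intro exI allI impI)
    qed
  qed
qed

definition cylinder :: "bool list \<Rightarrow> cantor set" where
  "cylinder s = {x. \<forall>i<length s. x i = s ! i}"

lemma cylinder_map: "y \<in> cylinder (map x [0..<n]) \<longleftrightarrow> agree n x y"
  unfolding cylinder_def agree_def by auto

lemma cylinder_iff_map: "x \<in> cylinder s \<longleftrightarrow> s = map x [0..<length s]"
  unfolding cylinder_def list_eq_iff_nth_eq by auto

lemma clopen_cylinder: "open (cylinder s) \<and> closed (cylinder s)"
  unfolding clopen_cantor_iff
proof (intro exI allI impI)
  fix x y assume "agree (length s) x y"
  then show "x \<in> cylinder s \<longleftrightarrow> y \<in> cylinder s"
    unfolding cylinder_def agree_def by simp
qed

lemmas open_cylinder = clopen_cylinder[THEN conjunct1]
  and closed_cylinder = clopen_cylinder[THEN conjunct2]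

lemma open_cantor_eq_UN_cylinder:
  assumes "open (S :: cantor set)"
  shows "S = (\<Union>s\<in>{s. cylinder s \<subseteq> S}. cylinder s)"
proof (intro equalityI subsetI)
  fix x assume "x \<in> S"
  with assms obtain n where "\<forall>y. agree n x y \<longrightarrow> y \<in> S"
    unfolding open_cantor_iff by (elim ballE exE) auto
  then have "cylinder (map x [0..<n]) \<subseteq> S"
    by (auto simp: cylinder_map)
  moreover have "x \<in> cylinder (map x [0..<n])"
    by (simp add: cylinder_map)
  ultimately show "x \<in> (\<Union>s\<in>{s. cylinder s \<subseteq> S}. cylinder s)"
    by blast
qed auto

section \<open>Pairs and sequences of points\<close>

definition pair :: "cantor \<Rightarrow> cantor \<Rightarrow> cantor" where
  "pair e x n = (if even n then e (n div 2) else x (n div 2))"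

definition left :: "cantor \<Rightarrow> cantor" where
  "left z n = z (2 * n)"

definition right :: "cantor \<Rightarrow> cantor" where
  "right z n = z (2 * n + 1)"

definition column :: "cantor \<Rightarrow> nat \<Rightarrow> cantor" where
  "column e i n = e (prod_encode (i, n))"

lemma left_pair [simp]: "left (pair e x) = e" and right_pair [simp]: "right (pair e x) = x"
  by (simp_all add: fun_eq_iff pair_def left_def right_def)

lemma exists_columns: "\<exists>e. \<forall>i. column e i = c i"
  by (rule exI[of _ "\<lambda>m. c (fst (prod_decode m)) (snd (prod_decode m))"])
    (simp add: fun_eq_iff column_def)

lemma agree_pair: "agree n x y \<Longrightarrow> agree n e e' \<Longrightarrow> agree n (pair e x) (pair e' y)"
  by (auto simp: agree_def pair_def)

lemma continuous_left: "continuous_on UNIV left"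
  unfolding left_def by (intro continuous_on_coordinatewise_then_product) simp

lemma continuous_right: "continuous_on UNIV right"
  unfolding right_def by (intro continuous_on_coordinatewise_then_product) simp

lemma continuous_column: "continuous_on UNIV (\<lambda>e. column e i)"
  unfolding column_def by (intro continuous_on_coordinatewise_then_product) simp

lemma continuous_pair:
  assumes "continuous_on UNIV (f :: cantor \<Rightarrow> cantor)" "continuous_on UNIV (g :: cantor \<Rightarrow> cantor)"
  shows "continuous_on UNIV (\<lambda>z. pair (f z) (g z))"
proof (rule continuous_on_coordinatewise_then_product)
  show "continuous_on UNIV (\<lambda>z. pair (f z) (g z) n)" for n
    using assms[THEN continuous_on_product_then_coordinatewise]
    unfolding pair_def by (cases "even n") simp_all
qed

section \<open>Closure properties of the Borel classes\<close>

lemma Sigma0_uminus_iff: "- S \<in> Sigma0 \<alpha> \<longleftrightarrow> S \<in> Pi0 \<alpha>"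
proof -
  have "(is_Sigma0 \<alpha> S \<longrightarrow> is_Pi0 \<alpha> (- S)) \<and> (is_Pi0 \<alpha> S \<longrightarrow> is_Sigma0 \<alpha> (- S))" for \<alpha> S
  proof (induction \<alpha> arbitrary: S rule: less_induct)
    case (less \<alpha>)
    show ?case
    proof (cases "\<alpha> = 0")
      case True
      then show ?thesis
        using Sigma0_0 Pi0_0 by (auto simp: Sigma0_def Pi0_def)
    next
      case False
      then have \<alpha>: "1 \<le> \<alpha>"
        by (simp add: countable_ordinal_one_le_iff)
      show ?thesis
      proof (intro conjI impI)
        assume "is_Sigma0 \<alpha> S"
        with \<alpha> obtain T :: "nat \<Rightarrow> cantor set" where "S = (\<Union>n. T n)" "\<And>n. \<exists>\<beta><\<alpha>. is_Pi0 \<beta> (T n)"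
          using Sigma0_iff[of \<alpha> S] by (auto simp: Sigma0_def Pi0_def)
        with less have "is_Pi0 \<alpha> (\<Inter>n. - T n)"
          by (intro Pi0_Inter \<alpha>) blast
        with \<open>S = _\<close> show "is_Pi0 \<alpha> (- S)"
          by (simp add: Compl_UN)
      next
        assume "is_Pi0 \<alpha> S"
        with \<alpha> obtain T :: "nat \<Rightarrow> cantor set" where "S = (\<Inter>n. T n)" "\<And>n. \<exists>\<beta><\<alpha>. is_Sigma0 \<beta> (T n)"
          using Pi0_iff[of \<alpha> S] by (auto simp: Sigma0_def Pi0_def)
        with less have "is_Sigma0 \<alpha> (\<Union>n. - T n)"
          by (intro Sigma0_Union \<alpha>) blast
        with \<open>S = _\<close> show "is_Sigma0 \<alpha> (- S)"
          by (simp add: Compl_INT)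
      qed
    qed
  qed
  from this[of \<alpha> S] this[of \<alpha> "- S"] show ?thesis
    by (auto simp: Sigma0_def Pi0_def)
qed

lemma Pi0_uminus_iff: "- S \<in> Pi0 \<alpha> \<longleftrightarrow> S \<in> Sigma0 \<alpha>"
  using Sigma0_uminus_iff[of "- S" \<alpha>] by simp

lemma clopen_in_Sigma0: "open S \<Longrightarrow> closed S \<Longrightarrow> S \<in> Sigma0 \<alpha>"
proof (cases "\<alpha> = 0")
  case False
  assume "open S" "closed S"
  with False show ?thesis
    by (subst Sigma0_iff)
      (auto simp: countable_ordinal_one_le_iff Pi0_0 order_less_le intro!: exI[of _ "\<lambda>_. S"] exI[of _ 0])
qed (simp add: Sigma0_0)

lemma clopen_in_Pi0: "open S \<Longrightarrow> closed S \<Longrightarrow> S \<in> Pi0 \<alpha>"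
  using clopen_in_Sigma0[of "- S" \<alpha>] by (simp add: Sigma0_uminus_iff open_Compl closed_Compl)

lemma Sigma0_UN_Pi0:
  assumes "1 \<le> \<alpha>" "countable I" "\<And>i. i \<in> I \<Longrightarrow> \<exists>\<beta><\<alpha>. S i \<in> Pi0 \<beta>"
  shows "(\<Union>i\<in>I. S i) \<in> Sigma0 \<alpha>"
proof (cases "I = {}")
  case False
  have "(\<Union>i\<in>I. S i) = (\<Union>n. S (from_nat_into I n))"
    by (metis SUP_image comp_apply image_image range_from_nat_into[OF False assms(2)])
  then show ?thesis
    using assms(1,3) from_nat_into[OF False] by (auto simp: Sigma0_iff)
qed (simp add: clopen_in_Sigma0)

lemma Pi0_subset_Sigma0:
  assumes "\<alpha> < \<beta>" "S \<in> Pi0 \<alpha>"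
  shows "S \<in> Sigma0 \<beta>"
proof -
  have "1 \<le> \<beta>"
    using assms(1) by (metis countable_ordinal_one_le_iff leD zero_le_countable_ordinal)
  with assms show ?thesis
    using Sigma0_UN_Pi0[of \<beta> "{()}" "\<lambda>_. S"] by auto
qed

lemma Sigma0_mono:
  assumes "\<alpha> \<le> \<beta>" "S \<in> Sigma0 \<alpha>"
  shows "S \<in> Sigma0 \<beta>"
proof (cases "\<alpha> = 0")
  case False
  then have "1 \<le> \<alpha>"
    by (simp add: countable_ordinal_one_le_iff)
  with assms obtain T :: "nat \<Rightarrow> cantor set"
    where "S = (\<Union>n. T n)" "\<And>n. \<exists>\<gamma><\<alpha>. T n \<in> Pi0 \<gamma>"
    by (auto simp: Sigma0_iff)
  moreover have "1 \<le> \<beta>"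
    using \<open>1 \<le> \<alpha>\<close> assms(1) by (rule order_trans)
  ultimately show ?thesis
    using assms(1) by (auto intro!: Sigma0_UN_Pi0 dest: less_le_trans)
next
  case True
  with assms(2) show ?thesis
    by (simp add: Sigma0_0 clopen_in_Sigma0)
qed

lemma Pi0_mono: "\<alpha> \<le> \<beta> \<Longrightarrow> S \<in> Pi0 \<alpha> \<Longrightarrow> S \<in> Pi0 \<beta>"
  using Sigma0_mono[of \<alpha> \<beta> "- S"] by (simp add: Sigma0_uminus_iff)

lemma Sigma0_UN:
  assumes "1 \<le> \<alpha>" "countable I" "\<And>i. i \<in> I \<Longrightarrow> S i \<in> Sigma0 \<alpha>"
  shows "(\<Union>i\<in>I. S i) \<in> Sigma0 \<alpha>"
proof -
  have "\<forall>i\<in>I. \<exists>T :: nat \<Rightarrow> cantor set. S i = (\<Union>n. T n) \<and> (\<forall>n. \<exists>\<beta><\<alpha>. T n \<in> Pi0 \<beta>)"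
    using assms by (simp add: Sigma0_iff)
  then obtain T :: "_ \<Rightarrow> nat \<Rightarrow> cantor set" where
    T: "\<And>i. i \<in> I \<Longrightarrow> S i = (\<Union>n. T i n)" "\<And>i n. i \<in> I \<Longrightarrow> \<exists>\<beta><\<alpha>. T i n \<in> Pi0 \<beta>"
    by metis
  have "(\<Union>i\<in>I. S i) = (\<Union>(i, n)\<in>I \<times> UNIV. T i n)"
    using T(1) by auto
  also have "\<dots> \<in> Sigma0 \<alpha>"
    using assms(1,2) T(2) by (intro Sigma0_UN_Pi0) auto
  finally show ?thesis .
qed

lemma Sigma0_Un:
  assumes "1 \<le> \<alpha>" "S \<in> Sigma0 \<alpha>" "T \<in> Sigma0 \<alpha>"
  shows "S \<union> T \<in> Sigma0 \<alpha>"
  using Sigma0_UN[of \<alpha> UNIV "\<lambda>b. if b then S else T"] assms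
  by (simp add: UNIV_bool Un_commute)

lemma Pi0_INT:
  assumes "1 \<le> \<alpha>" "countable I" "\<And>i. i \<in> I \<Longrightarrow> S i \<in> Pi0 \<alpha>"
  shows "(\<Inter>i\<in>I. S i) \<in> Pi0 \<alpha>"
proof -
  have "- (\<Inter>i\<in>I. S i) \<in> Sigma0 \<alpha>"
    unfolding Compl_INT using assms by (intro Sigma0_UN) (auto simp: Sigma0_uminus_iff)
  then show ?thesis
    by (simp only: Sigma0_uminus_iff)
qed

lemma Pi0_Int:
  assumes "S \<in> Pi0 \<alpha>" "T \<in> Pi0 \<alpha>"
  shows "S \<inter> T \<in> Pi0 \<alpha>"
proof (cases "\<alpha> = 0")
  case False
  then show ?thesis
    using Pi0_INT[of \<alpha> UNIV "\<lambda>b. if b then S else T"] assms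
    by (simp add: countable_ordinal_one_le_iff UNIV_bool Int_commute)
qed (use assms in \<open>simp add: Pi0_0 open_Int closed_Int\<close>)

text \<open>The union over pairs works because two sets from lower levels \<open>\<beta>\<close> and \<open>\<gamma>\<close> share
  the level \<open>max \<beta> \<gamma>\<close>, which is still below \<open>\<alpha>\<close>.\<close>

lemma Sigma0_Int:
  assumes "1 \<le> \<alpha>" "S \<in> Sigma0 \<alpha>" "T \<in> Sigma0 \<alpha>"
  shows "S \<inter> T \<in> Sigma0 \<alpha>"
proof -
  obtain S' T' :: "nat \<Rightarrow> cantor set" where
    S': "S = (\<Union>n. S' n)" "\<And>n. \<exists>\<beta><\<alpha>. S' n \<in> Pi0 \<beta>" and
    T': "T = (\<Union>n. T' n)" "\<And>n. \<exists>\<beta><\<alpha>. T' n \<in> Pi0 \<beta>"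
    using assms by (auto simp: Sigma0_iff)
  have "\<exists>\<beta><\<alpha>. S' m \<inter> T' n \<in> Pi0 \<beta>" for m n
  proof -
    obtain \<beta> \<gamma> where "\<beta> < \<alpha>" "S' m \<in> Pi0 \<beta>" "\<gamma> < \<alpha>" "T' n \<in> Pi0 \<gamma>"
      using S'(2) T'(2) by blast
    then show ?thesis
      by (intro exI[of _ "max \<beta> \<gamma>"]) (simp, metis Pi0_Int Pi0_mono max.cobounded1 max.cobounded2)
  qed
  then have "(\<Union>(m, n)\<in>UNIV. S' m \<inter> T' n) \<in> Sigma0 \<alpha>"
    using assms(1) by (intro Sigma0_UN_Pi0) auto
  also have "(\<Union>(m, n)\<in>UNIV. S' m \<inter> T' n) = S \<inter> T"
    unfolding S' T' by auto
  finally show ?thesis .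
qed

lemma Sigma0_continuous_vimage:
  assumes "continuous_on UNIV \<phi>" "S \<in> Sigma0 \<alpha>"
  shows "\<phi> -` S \<in> Sigma0 \<alpha>"
  using assms(2)
proof (induction \<alpha> arbitrary: S rule: less_induct)
  case (less \<alpha>)
  show ?case
  proof (cases "\<alpha> = 0")
    case True
    with less.prems assms(1) show ?thesis
      by (simp add: Sigma0_0 open_vimage closed_vimage)
  next
    case False
    then have \<alpha>: "1 \<le> \<alpha>"
      by (simp add: countable_ordinal_one_le_iff)
    with less.prems obtain T :: "nat \<Rightarrow> cantor set"
      where T: "S = (\<Union>n. T n)" "\<And>n. \<exists>\<beta><\<alpha>. T n \<in> Pi0 \<beta>"
      by (auto simp: Sigma0_iff)
    have "\<exists>\<beta><\<alpha>. \<phi> -` T n \<in> Pi0 \<beta>" for n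
    proof -
      obtain \<beta> where "\<beta> < \<alpha>" "T n \<in> Pi0 \<beta>"
        using T(2) by blast
      with less.IH[of \<beta> "- T n"] show ?thesis
        by (auto simp: Sigma0_uminus_iff vimage_Compl)
    qed
    with \<alpha> show ?thesis
      unfolding T(1) vimage_UN by (intro Sigma0_UN_Pi0) auto
  qed
qed

lemma Pi0_continuous_vimage:
  "continuous_on UNIV \<phi> \<Longrightarrow> S \<in> Pi0 \<alpha> \<Longrightarrow> \<phi> -` S \<in> Pi0 \<alpha>"
  using Sigma0_continuous_vimage[of \<phi> "- S" \<alpha>] by (simp add: Sigma0_uminus_iff vimage_Compl)

lemma Sigma0_one: "Sigma0 1 = {S. open S}"
proof (intro set_eqI iffI)
  fix S assume "S \<in> Sigma0 1"
  then show "S \<in> {S. open S}"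
    by (auto simp: Sigma0_iff countable_ordinal_less_one_iff Pi0_0)
next
  fix S :: "cantor set" assume "S \<in> {S. open S}"
  then have "S = (\<Union>s\<in>{s. cylinder s \<subseteq> S}. cylinder s)"
    by (simp flip: open_cantor_eq_UN_cylinder)
  also have "\<dots> \<in> Sigma0 1"
    by (intro Sigma0_UN_Pi0)
      (auto simp: countable_ordinal_less_one_iff Pi0_0 open_cylinder closed_cylinder)
  finally show "S \<in> Sigma0 1" .
qed

text \<open>The case \<open>\<beta> = 1\<close> is the definition of measurability.  Above it, the clopen sets that occur
  in a representation of \<open>S\<close> are treated as sets of level \<open>1\<close>, since \<open>h\<close> is only known to pull them
  back to level \<open>\<alpha> + 1\<close>.\<close>

lemma Sigma0_measurable_vimage:
  assumes h: "Sigma0_measurable (\<alpha> + 1) h" and "1 \<le> \<beta>" "S \<in> Sigma0 \<beta>"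
  shows "h -` S \<in> Sigma0 (\<alpha> + \<beta>)"
  using assms(2,3)
proof (induction \<beta> arbitrary: S rule: less_induct)
  case (less \<beta>)
  show ?case
  proof (cases "\<beta> = 1")
    case True
    with less.prems h show ?thesis
      by (auto simp: Sigma0_measurable_def Sigma0_one)
  next
    case False
    with less.prems have "1 < \<beta>"
      by simp
    obtain T :: "nat \<Rightarrow> cantor set" where T: "S = (\<Union>n. T n)" "\<And>n. \<exists>\<gamma><\<beta>. T n \<in> Pi0 \<gamma>"
      using less.prems by (auto simp: Sigma0_iff)
    have "\<exists>\<delta><\<alpha> + \<beta>. h -` T n \<in> Pi0 \<delta>" for n
    proof -
      obtain \<gamma> where "\<gamma> < \<beta>" "T n \<in> Pi0 \<gamma>"
        using T(2) by blast
      with \<open>1 < \<beta>\<close> have "max 1 \<gamma> < \<beta>" "- T n \<in> Sigma0 (max 1 \<gamma>)"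
        by (auto simp: Sigma0_uminus_iff intro: Pi0_mono[of \<gamma>])
      with less.IH[of "max 1 \<gamma>" "- T n"] have "h -` T n \<in> Pi0 (\<alpha> + max 1 \<gamma>)"
        by (simp add: vimage_Compl Sigma0_uminus_iff)
      then show ?thesis
        using add_strict_left_mono_countable_ordinal[OF \<open>max 1 \<gamma> < \<beta>\<close>] by blast
    qed
    moreover have "1 \<le> \<alpha> + \<beta>"
      using add_strict_left_mono_countable_ordinal[OF \<open>1 < \<beta>\<close>, of \<alpha>]
      by (metis countable_ordinal_one_le_iff leD zero_le_countable_ordinal)
    ultimately show ?thesis
      unfolding T(1) vimage_UN by (intro Sigma0_UN_Pi0) auto
  qed
qed

section \<open>Universal sets\<close>

text \<open>A point \<open>c\<close> codes an open set by marking the basic clopen sets contained in it, and a set of a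
  higher class by its columns, which code the complements of the pieces of a union.  Level \<open>0\<close> is
  excluded because a diagonal argument shows that no clopen set is universal for the clopen sets.\<close>

lemma universal_Sigma0_exists:
  assumes "1 \<le> \<alpha>"
  shows "\<exists>W\<in>Sigma0 \<alpha>. \<forall>F\<in>Sigma0 \<alpha>. \<exists>c. \<forall>x. x \<in> F \<longleftrightarrow> pair c x \<in> W"
  using assms
proof (induction \<alpha> rule: less_induct)
  case (less \<alpha>)
  show ?case
  proof (cases "\<alpha> = 1")
    case True
    define W where "W = (\<Union>s :: bool list. (\<lambda>z. left z (to_nat s)) -` {True} \<inter> right -` cylinder s)"
    have "open ((\<lambda>z. left z (to_nat s)) -` {True} \<inter> right -` cylinder s)" for s :: "bool list"
      using continuous_on_product_then_coordinatewise[OF continuous_left]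
      by (intro open_Int open_vimage open_cylinder continuous_right) (simp_all add: open_discrete)
    then have "W \<in> Sigma0 \<alpha>"
      unfolding True Sigma0_one W_def by auto
    moreover have "\<exists>c. \<forall>x. x \<in> F \<longleftrightarrow> pair c x \<in> W" if "F \<in> Sigma0 \<alpha>" for F
    proof (intro exI[of _ "\<lambda>m. cylinder (from_nat m) \<subseteq> F"] allI)
      fix x
      have F: "F = (\<Union>s\<in>{s. cylinder s \<subseteq> F}. cylinder s)"
        using that unfolding True Sigma0_one by (intro open_cantor_eq_UN_cylinder) simp
      have "pair (\<lambda>m. cylinder (from_nat m) \<subseteq> F) x \<in> W \<longleftrightarrow> (\<exists>s. cylinder s \<subseteq> F \<and> x \<in> cylinder s)"
        by (simp add: W_def)
      then show "x \<in> F \<longleftrightarrow> pair (\<lambda>m. cylinder (from_nat m) \<subseteq> F) x \<in> W"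
        using F by blast
    qed
    ultimately show ?thesis
      by blast
  next
    case False
    with less.prems have "1 < \<alpha>"
      by simp
    then have I: "{1..<\<alpha>} \<noteq> {}" "countable {1..<\<alpha>}"
      by (auto intro: countable_subset[OF _ countable_lessThan_countable_ordinal[of \<alpha>]])
    \<comment> \<open>The \<open>n\<close>-th column codes a set of a level fixed in advance.  Every level in question is
      assigned to infinitely many columns, so any union can be arranged to fit; columns left
      over code the complement of the empty set.\<close>
    define \<rho> where "\<rho> n = from_nat_into {1..<\<alpha>} (fst (prod_decode n))" for n
    have \<rho>: "1 \<le> \<rho> n" "\<rho> n < \<alpha>" for n
      using from_nat_into[OF I(1)] by (simp_all add: \<rho>_def)
    obtain W where W: "\<And>n. W n \<in> Sigma0 (\<rho> n)"
      "\<And>n F. F \<in> Sigma0 (\<rho> n) \<Longrightarrow> \<exists>c. \<forall>x. x \<in> F \<longleftrightarrow> pair c x \<in> W n"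
      using less.IH[OF \<rho>(2,1)] by metis
    define V where "V = (\<Union>n. (\<lambda>z. pair (column (left z) n) (right z)) -` (- W n))"
    have "(\<lambda>z. pair (column (left z) n) (right z)) -` (- W n) \<in> Pi0 (\<rho> n)" for n
      using W(1) by (intro Pi0_continuous_vimage continuous_pair continuous_right
          continuous_on_compose2[OF continuous_column continuous_left]) (auto simp: Pi0_uminus_iff)
    then have "V \<in> Sigma0 \<alpha>"
      unfolding V_def using less.prems \<rho>(2) by (intro Sigma0_UN_Pi0) auto
    moreover have "\<exists>c. \<forall>x. x \<in> F \<longleftrightarrow> pair c x \<in> V" if F: "F \<in> Sigma0 \<alpha>" for F
    proof -
      obtain S :: "nat \<Rightarrow> cantor set" where S: "F = (\<Union>l. S l)" "\<And>l. \<exists>\<beta><\<alpha>. S l \<in> Pi0 \<beta>"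
        using F less.prems by (auto simp: Sigma0_iff)
      define T where "T n = (let l = snd (prod_decode n) in if S l \<in> Pi0 (\<rho> n) then S l else {})" for n
      have FT: "F = (\<Union>n. T n)"
      proof (intro equalityI subsetI)
        fix x assume "x \<in> F"
        then obtain l where "x \<in> S l"
          by (auto simp: S(1))
        obtain \<beta> where "\<beta> < \<alpha>" "S l \<in> Pi0 \<beta>"
          using S(2) by blast
        then have "max 1 \<beta> \<in> {1..<\<alpha>}" "S l \<in> Pi0 (max 1 \<beta>)"
          using \<open>1 < \<alpha>\<close> by (auto intro: Pi0_mono[of \<beta>])
        then obtain k where "S l \<in> Pi0 (from_nat_into {1..<\<alpha>} k)"
          using from_nat_into_surj[OF I(2)] by metis
        with \<open>x \<in> S l\<close> have "x \<in> T (prod_encode (k, l))"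
          by (simp add: T_def \<rho>_def)
        then show "x \<in> (\<Union>n. T n)"
          by blast
      qed (auto simp: S(1) T_def Let_def split: if_splits)
      have "- T n \<in> Sigma0 (\<rho> n)" for n
        by (auto simp: T_def Let_def Sigma0_uminus_iff clopen_in_Pi0)
      then have "\<exists>c. \<forall>x. x \<in> - T n \<longleftrightarrow> pair c x \<in> W n" for n
        by (rule W(2))
      then obtain c where c: "\<And>n x. x \<in> - T n \<longleftrightarrow> pair (c n) x \<in> W n"
        by metis
      obtain e where "\<And>n. column e n = c n"
        using exists_columns by blast
      then have "x \<in> F \<longleftrightarrow> pair e x \<in> V" for x
        unfolding FT V_def by (simp flip: c)
      then show ?thesis
        by blast
    qed
    ultimately show ?thesis
      by blast
  qed
qed

section \<open>Borel codes and Cohen forcing\<close>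

text \<open>\<open>Nor f\<close> stands for the union of the complements of the sets coded by the \<open>f n\<close>, so a code
  only needs one kind of node.  Forcing is a recursion over codes rather than over sets, since it
  depends on how a set was built.\<close>

datatype borel_code = Basic "cantor set" | Nor "nat \<Rightarrow> borel_code"

primrec denote :: "borel_code \<Rightarrow> cantor set" where
  "denote (Basic S) = S"
| "denote (Nor f) = (\<Union>n. - denote (f n))"

primrec has_rank :: "borel_code \<Rightarrow> countable_ordinal \<Rightarrow> bool" where
  "has_rank (Basic S) = (\<lambda>\<alpha>. open S \<and> closed S)"
| "has_rank (Nor f) = (\<lambda>\<alpha>. 1 \<le> \<alpha> \<and> (\<forall>n. \<exists>\<beta><\<alpha>. has_rank (f n) \<beta>))"

primrec subcodes :: "borel_code \<Rightarrow> borel_code set" where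
  "subcodes (Basic S) = {Basic S}"
| "subcodes (Nor f) = insert (Nor f) (\<Union>n. subcodes (f n))"

lemma Sigma0_has_code: "S \<in> Sigma0 \<alpha> \<Longrightarrow> \<exists>c. has_rank c \<alpha> \<and> denote c = S"
proof (induction \<alpha> arbitrary: S rule: less_induct)
  case (less \<alpha>)
  show ?case
  proof (cases "\<alpha> = 0")
    case True
    with less.prems show ?thesis
      by (intro exI[of _ "Basic S"]) (simp add: Sigma0_0)
  next
    case False
    then have \<alpha>: "1 \<le> \<alpha>"
      by (simp add: countable_ordinal_one_le_iff)
    with less.prems obtain T :: "nat \<Rightarrow> cantor set"
      where T: "S = (\<Union>n. T n)" "\<And>n. \<exists>\<beta><\<alpha>. T n \<in> Pi0 \<beta>"
      by (auto simp: Sigma0_iff)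
    have "\<exists>c. (\<exists>\<beta><\<alpha>. has_rank c \<beta>) \<and> denote c = - T n" for n
    proof -
      obtain \<beta> where "\<beta> < \<alpha>" "- T n \<in> Sigma0 \<beta>"
        using T(2) by (auto simp: Sigma0_uminus_iff)
      then show ?thesis
        using less.IH by blast
    qed
    then obtain f where "\<And>n. \<exists>\<beta><\<alpha>. has_rank (f n) \<beta>" "\<And>n. denote (f n) = - T n"
      by metis
    with \<alpha> show ?thesis
      by (intro exI[of _ "Nor f"]) (simp add: T(1))
  qed
qed

lemma countable_subcodes: "countable (subcodes c)"
  by (induction c) auto

lemma self_in_subcodes: "c \<in> subcodes c"
  by (cases c) auto

lemma subcodes_child: "Nor f \<in> subcodes c \<Longrightarrow> f n \<in> subcodes c"
proof (induction c)
  case (Nor g)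
  then show ?case
    using self_in_subcodes[of "f n"] by (cases "Nor f = Nor g") auto
qed simp

lemma has_rank_subcodes:
  "has_rank c \<alpha> \<Longrightarrow> d \<in> subcodes c \<Longrightarrow> \<exists>\<beta>\<le>\<alpha>. has_rank d \<beta>"
proof (induction c arbitrary: \<alpha>)
  case (Nor f)
  show ?case
  proof (cases "d = Nor f")
    case False
    then obtain n where "d \<in> subcodes (f n)"
      using Nor.prems(2) by auto
    moreover obtain \<beta> where "\<beta> < \<alpha>" "has_rank (f n) \<beta>"
      using Nor.prems(1) by auto
    ultimately obtain \<gamma> where "\<gamma> \<le> \<beta>" "has_rank d \<gamma>"
      using Nor.IH[of "f n"] by blast
    with \<open>\<beta> < \<alpha>\<close> show ?thesis
      by (intro exI[of _ \<gamma>]) simp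
  qed (use Nor.prems in auto)
qed auto

text \<open>Cohen forcing with a parameter: the conditions \<open>t\<close> are finite initial segments of a point
  \<open>x\<close>, while \<open>e\<close> is fixed, and the statement forced is that \<open>pair e x\<close> lies in the coded set.
  The inner clause of the second equation is \<open>refutes\<close>, written out for the recursion.\<close>

primrec forces :: "borel_code \<Rightarrow> cantor \<Rightarrow> bool list \<Rightarrow> bool" where
  "forces (Basic S) = (\<lambda>e t. \<forall>x\<in>cylinder t. pair e x \<in> S)"
| "forces (Nor f) = (\<lambda>e t. \<exists>n. \<forall>t'. prefix t t' \<longrightarrow> \<not> forces (f n) e t')"

definition refutes :: "borel_code \<Rightarrow> cantor \<Rightarrow> bool list \<Rightarrow> bool" where
  "refutes c e t \<longleftrightarrow> (\<forall>t'. prefix t t' \<longrightarrow> \<not> forces c e t')"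

lemma forces_Nor: "forces (Nor f) e t \<longleftrightarrow> (\<exists>n. refutes (f n) e t)"
  by (simp add: refutes_def)

lemma cylinder_antimono: "prefix s t \<Longrightarrow> cylinder t \<subseteq> cylinder s"
  by (auto simp: cylinder_def prefix_def nth_append)

lemma cylinder_prefix_cases:
  assumes "x \<in> cylinder s" "x \<in> cylinder t"
  shows "prefix s t \<or> prefix t s"
proof -
  have "prefix (map x [0..<m]) (map x [0..<n])" if "m \<le> n" for m n
    using that by (metis map_append prefixI upt_add_eq_append le_add_diff_inverse zero_le)
  then show ?thesis
    using assms[unfolded cylinder_iff_map] by (metis nle_le)
qed

lemma refutes_mono: "refutes c e t \<Longrightarrow> prefix t t' \<Longrightarrow> refutes c e t'"
  unfolding refutes_def by (meson prefix_order.trans)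

lemma forces_mono:
  assumes "forces c e t" "prefix t t'"
  shows "forces c e t'"
proof (cases c)
  case (Basic S)
  with assms show ?thesis
    using cylinder_antimono by auto
next
  case (Nor f)
  with assms show ?thesis
    unfolding Nor forces_Nor using refutes_mono by blast
qed

lemma clopen_pairD:
  assumes "open S" "closed S"
  obtains n where "\<And>x y e e'. agree n x y \<Longrightarrow> agree n e e' \<Longrightarrow> pair e x \<in> S \<longleftrightarrow> pair e' y \<in> S"
  using assms clopen_cantor_iff[of S] agree_pair by metis

text \<open>For a clopen set the quantifier over extensions in \<open>refutes\<close> disappears.  This keeps the
  leaves of a code at level \<open>0\<close>; bounding that quantifier by a countable intersection
  would only give a closed set of parameters.\<close>

lemma refutes_Basic:
  assumes "open S" "closed S"
  shows "refutes (Basic S) e t \<longleftrightarrow> forces (Basic (- S)) e t"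
proof
  assume r: "refutes (Basic S) e t"
  obtain n where n: "\<And>x y e e'. agree n x y \<Longrightarrow> agree n e e' \<Longrightarrow> pair e x \<in> S \<longleftrightarrow> pair e' y \<in> S"
    using clopen_pairD assms by blast
  have "pair e x \<notin> S" if "x \<in> cylinder t" for x
  proof
    assume x: "pair e x \<in> S"
    define t' where "t' = map x [0..<max n (length t)]"
    have "pair e y \<in> S" if "y \<in> cylinder t'" for y
    proof -
      have "agree n x y"
        using that agree_mono unfolding t'_def cylinder_map by (metis max.cobounded1)
      with x n show ?thesis
        using agree_refl by metis
    qed
    then have "forces (Basic S) e t'"
      by simp
    moreover have "prefix t t'"
    proof -
      have "x \<in> cylinder t'"
        by (simp add: t'_def cylinder_map)
      then have "prefix t t' \<or> prefix t' t"
        using that cylinder_prefix_cases by blast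
      moreover have "length t \<le> length t'"
        by (simp add: t'_def)
      ultimately show ?thesis
        by (metis prefix_length_le le_antisym prefix_order.order_refl not_equal_is_parallel parallel_def)
    qed
    ultimately show False
      using r unfolding refutes_def by blast
  qed
  then show "forces (Basic (- S)) e t"
    by simp
next
  assume f: "forces (Basic (- S)) e t"
  have "\<not> forces (Basic S) e t'" if "prefix t t'" for t'
  proof -
    define x where "x i = (if i < length t' then t' ! i else False)" for i
    have "x \<in> cylinder t'"
      by (simp add: x_def cylinder_def)
    then show ?thesis
      using f cylinder_antimono[OF that] by auto
  qed
  then show "refutes (Basic S) e t"
    by (simp add: refutes_def)
qed

lemma clopen_forces_Basic:
  assumes "open S" "closed S"
  shows "open {e. forces (Basic S) e t} \<and> closed {e. forces (Basic S) e t}"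
proof -
  obtain n where n: "\<And>x y e e'. agree n x y \<Longrightarrow> agree n e e' \<Longrightarrow> pair e x \<in> S \<longleftrightarrow> pair e' y \<in> S"
    using clopen_pairD assms by blast
  have "forces (Basic S) e t \<longleftrightarrow> forces (Basic S) e' t" if "agree n e e'" for e e'
    using n[OF agree_refl that] by simp
  then show ?thesis
    unfolding clopen_cantor_iff by blast
qed

text \<open>Forcing is no more complex than the set it speaks about: for fixed \<open>t\<close>, the set of
  parameters \<open>e\<close> belongs to the class of the code.  The countably many extensions of a condition
  are absorbed by the countable unions and intersections of the classes.\<close>

lemma forces_refutes_rank:
  assumes "has_rank c \<alpha>"
  shows "{e. forces c e t} \<in> Sigma0 \<alpha> \<and> {e. refutes c e t} \<in> Pi0 \<alpha>"
  using assms
proof (induction c arbitrary: \<alpha> t)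
  case (Basic S)
  then have "{e. refutes (Basic S) e t} = {e. forces (Basic (- S)) e t}"
    by (simp add: refutes_Basic)
  with Basic show ?case
    using clopen_forces_Basic[of S t] clopen_forces_Basic[of "- S" t]
    by (simp add: clopen_in_Sigma0 clopen_in_Pi0 open_Compl closed_Compl del: forces.simps)
next
  case (Nor f)
  have "\<exists>\<beta><\<alpha>. {e. refutes (f n) e t} \<in> Pi0 \<beta>" for n t
    using Nor.IH[OF rangeI] Nor.prems by simp blast
  then have "(\<Union>n. {e. refutes (f n) e t}) \<in> Sigma0 \<alpha>" for t
    using Nor.prems by (intro Sigma0_UN_Pi0) auto
  then have forces: "{e. forces (Nor f) e t} \<in> Sigma0 \<alpha>" for t
    unfolding forces_Nor by (simp add: Collect_ex_eq)
  have "{e. refutes (Nor f) e t} = (\<Inter>t'\<in>{t'. prefix t t'}. - {e. forces (Nor f) e t'})"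
    unfolding refutes_def by auto
  also have "\<dots> \<in> Pi0 \<alpha>"
    using forces Nor.prems by (intro Pi0_INT) (auto simp: Pi0_uminus_iff simp del: forces.simps)
  finally show ?case
    using forces by blast
qed

lemma forces_not_refutes:
  assumes "x \<in> cylinder s" "forces c e s" "x \<in> cylinder t"
  shows "\<not> refutes c e t"
  using cylinder_prefix_cases[OF assms(1,3)] forces_mono[OF assms(2)]
  by (auto simp: refutes_def assms(2))

text \<open>For a point \<open>x\<close> that decides every subcode, membership in a coded set is equivalent to being
  forced by an initial segment of \<open>x\<close>.  At a node, \<open>pair e x\<close> is outside the set of a child
  iff no initial segment forces the child, and then the segment that decides it refutes it.\<close>

lemma forcing_truth:
  assumes generic: "\<And>c. c \<in> C \<Longrightarrow> \<exists>t. x \<in> cylinder t \<and> (forces c e t \<or> refutes c e t)"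
    and child: "\<And>f n. Nor f \<in> C \<Longrightarrow> f n \<in> C"
    and rank: "\<And>c. c \<in> C \<Longrightarrow> \<exists>\<alpha>. has_rank c \<alpha>"
    and "c \<in> C"
  shows "pair e x \<in> denote c \<longleftrightarrow> (\<exists>t. x \<in> cylinder t \<and> forces c e t)"
proof -
  show ?thesis
    using \<open>c \<in> C\<close>
  proof (induction c)
    case (Basic S)
    then have S: "open S" "closed S"
      using rank by fastforce+
    show ?case
    proof
      assume "pair e x \<in> denote (Basic S)"
      with generic[OF Basic] show "\<exists>t. x \<in> cylinder t \<and> forces (Basic S) e t"
        by (auto simp: refutes_Basic[OF S])
    qed auto
  next
    case (Nor f)
    have "pair e x \<notin> denote (f n) \<longleftrightarrow> (\<exists>t. x \<in> cylinder t \<and> refutes (f n) e t)" for n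
      using Nor.IH[OF rangeI child[OF Nor.prems]] generic[OF child[OF Nor.prems]] forces_not_refutes by blast
    then show ?case
      unfolding forces_Nor by auto
  qed
qed

section \<open>Definition by countably many cases\<close>

text \<open>For a countable range this is measurability with respect to the discrete topology on it.\<close>

definition discretely_measurable :: "countable_ordinal \<Rightarrow> (cantor \<Rightarrow> 'a) \<Rightarrow> bool" where
  "discretely_measurable \<gamma> q \<longleftrightarrow> (\<forall>a. {z. q z = a} \<in> Sigma0 \<gamma>)"

lemma discretely_measurable_bind:
  fixes q :: "cantor \<Rightarrow> 'a :: countable"
  assumes "1 \<le> \<gamma>" "discretely_measurable \<gamma> q" "\<And>a. discretely_measurable \<gamma> (r a)"
  shows "discretely_measurable \<gamma> (\<lambda>z. r (q z) z)"
  unfolding discretely_measurable_def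
proof
  fix b
  have "{z. r (q z) z = b} = (\<Union>a. {z. q z = a} \<inter> {z. r a z = b})"
    by auto
  also have "\<dots> \<in> Sigma0 \<gamma>"
    using assms by (intro Sigma0_UN Sigma0_Int) (auto simp: discretely_measurable_def)
  finally show "{z. r (q z) z = b} \<in> Sigma0 \<gamma>" .
qed

lemma discretely_measurable_const: "discretely_measurable \<gamma> (\<lambda>_. a)"
  by (simp add: discretely_measurable_def clopen_in_Sigma0)

lemma discretely_measurable_continuous_compose:
  assumes "continuous_on UNIV \<phi>" "discretely_measurable \<gamma> q"
  shows "discretely_measurable \<gamma> (\<lambda>z. q (\<phi> z))"
  unfolding discretely_measurable_def
proof
  show "{z. q (\<phi> z) = a} \<in> Sigma0 \<gamma>" for a
    using Sigma0_continuous_vimage[OF assms(1), of "{z. q z = a}"] assms(2)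
    by (simp add: discretely_measurable_def vimage_def)
qed

lemma discretely_measurable_coordinate: "discretely_measurable \<gamma> (\<lambda>x. g (x i))"
  unfolding discretely_measurable_def
proof
  fix a
  have "open {x :: cantor. g (x i) = a} \<and> closed {x :: cantor. g (x i) = a}"
    unfolding clopen_cantor_iff by (intro exI[of _ "Suc i"]) (simp add: agree_def)
  then show "{x. g (x i) = a} \<in> Sigma0 \<gamma>"
    by (simp add: clopen_in_Sigma0)
qed

lemma Sigma0_measurableI:
  assumes "1 \<le> \<gamma>" "\<And>k. discretely_measurable \<gamma> (\<lambda>z. h z k)"
  shows "Sigma0_measurable \<gamma> h"
  unfolding Sigma0_measurable_def
proof (intro allI impI)
  fix U :: "cantor set" assume "open U"
  have "{z. \<forall>i<n. h z i = s ! i} \<in> Sigma0 \<gamma>" for n and s :: "bool list"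
  proof (induction n)
    case (Suc n)
    have "{z. \<forall>i<Suc n. h z i = s ! i} = {z. \<forall>i<n. h z i = s ! i} \<inter> {z. h z n = s ! n}"
      by (auto simp: less_Suc_eq)
    also have "\<dots> \<in> Sigma0 \<gamma>"
      using assms Suc by (intro Sigma0_Int) (auto simp: discretely_measurable_def)
    finally show ?case .
  qed (simp add: clopen_in_Sigma0)
  then have cyl: "h -` cylinder s \<in> Sigma0 \<gamma>" for s
    by (simp add: cylinder_def vimage_def)
  have "h -` U = (\<Union>s\<in>{s. cylinder s \<subseteq> U}. h -` cylinder s)"
    using open_cantor_eq_UN_cylinder[OF \<open>open U\<close>] by blast
  also have "\<dots> \<in> Sigma0 \<gamma>"
    using cyl assms(1) by (intro Sigma0_UN) auto
  finally show "h -` U \<in> Sigma0 \<gamma>" .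
qed

section \<open>Jump inversion\<close>

text \<open>The default value \<open>s\<close> also decides the code: if no extension of \<open>s\<close> forces it, then \<open>s\<close>
  refutes it.\<close>

definition decide :: "(nat \<Rightarrow> borel_code) \<Rightarrow> cantor \<Rightarrow> nat \<Rightarrow> bool list \<Rightarrow> bool list" where
  "decide N e k s = (if \<exists>t. prefix s t \<and> forces (N k) e t
     then from_nat (LEAST m. prefix s (from_nat m) \<and> forces (N k) e (from_nat m)) else s)"

text \<open>Two runs of one construction: decide the next code, then append one bit.  In \<open>build\<close> the
  appended bit is the next bit of \<open>y\<close>; in \<open>retrace\<close> it is read from the given point \<open>x\<close>.  On the
  point \<open>generic N e y\<close> that results from \<open>build\<close>, the second run repeats the first, so the bits it
  meets are those of \<open>y\<close>, and \<open>jump\<close> returns them.\<close>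

primrec retrace :: "(nat \<Rightarrow> borel_code) \<Rightarrow> cantor \<Rightarrow> cantor \<Rightarrow> nat \<Rightarrow> bool list" where
  "retrace N e x 0 = []"
| "retrace N e x (Suc k) = (let t = decide N e k (retrace N e x k) in t @ [x (length t)])"

primrec build :: "(nat \<Rightarrow> borel_code) \<Rightarrow> cantor \<Rightarrow> cantor \<Rightarrow> nat \<Rightarrow> bool list" where
  "build N e y 0 = []"
| "build N e y (Suc k) = decide N e k (build N e y k) @ [y k]"

definition generic :: "(nat \<Rightarrow> borel_code) \<Rightarrow> cantor \<Rightarrow> cantor \<Rightarrow> cantor" where
  "generic N e y n = build N e y (Suc n) ! n"

definition jump :: "(nat \<Rightarrow> borel_code) \<Rightarrow> cantor \<Rightarrow> cantor" where
  "jump N z k = right z (length (decide N (left z) k (retrace N (left z) (right z) k)))"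

lemma decide:
  shows prefix_decide: "prefix s (decide N e k s)"
    and decide_cases: "forces (N k) e (decide N e k s) \<or> refutes (N k) e (decide N e k s)"
proof -
  have "prefix s (decide N e k s) \<and>
    (forces (N k) e (decide N e k s) \<or> refutes (N k) e (decide N e k s))"
  proof (cases "\<exists>t. prefix s t \<and> forces (N k) e t")
    case True
    then obtain t where "prefix s t \<and> forces (N k) e t"
      by blast
    then have "prefix s (from_nat (to_nat t)) \<and> forces (N k) e (from_nat (to_nat t))"
      by simp
    then have "prefix s (from_nat (LEAST m. prefix s (from_nat m) \<and> forces (N k) e (from_nat m))) \<and>
        forces (N k) e (from_nat (LEAST m. prefix s (from_nat m) \<and> forces (N k) e (from_nat m)))"
      by (rule LeastI)
    with True show ?thesis
      by (simp add: decide_def)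
  next
    case False
    then show ?thesis
      by (auto simp: decide_def refutes_def)
  qed
  then show "prefix s (decide N e k s)"
    "forces (N k) e (decide N e k s) \<or> refutes (N k) e (decide N e k s)"
    by blast+
qed

text \<open>Being the first extension that forces is a finite Boolean combination of conditions at level
  \<open>\<alpha>\<close>, and having no such extension is a condition of class \<open>\<Pi>\<close> at level \<open>\<alpha>\<close>; both are of class
  \<open>\<Sigma>\<close> one level higher.\<close>

lemma discretely_measurable_decide:
  assumes \<alpha>: "1 \<le> \<alpha>" and forces: "\<And>t. {e. forces (N k) e t} \<in> Sigma0 \<alpha>"
  shows "discretely_measurable (\<alpha> + 1) (\<lambda>e. decide N e k s)"
  unfolding discretely_measurable_def
proof
  fix t
  have one: "1 \<le> \<alpha> + 1" and less: "\<alpha> < \<alpha> + 1"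
    by (simp_all add: one_le_add_one less_add_one_countable_ordinal_iff)
  define P where "P m = {e. prefix s (from_nat m) \<and> forces (N k) e (from_nat m)}" for m
  have P: "P m \<in> Sigma0 \<alpha>" for m
    using forces by (cases "prefix s (from_nat m)") (simp_all add: P_def clopen_in_Sigma0)
  have none: "(\<Inter>m\<in>I. - P m) \<in> Sigma0 (\<alpha> + 1)" for I
    using \<alpha> less P by (intro Pi0_subset_Sigma0[OF less] Pi0_INT) (auto simp: Pi0_uminus_iff)
  have none_iff: "e \<in> (\<Inter>m. - P m) \<longleftrightarrow> \<not> (\<exists>t. prefix s t \<and> forces (N k) e t)" for e
    by (simp add: P_def) (metis from_nat_to_nat)
  have "{e. decide N e k s = t} =
    (\<Union>m\<in>{m. from_nat m = t}. P m \<inter> (\<Inter>i\<in>{..<m}. - P i)) \<union> (if t = s then (\<Inter>m. - P m) else {})"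
  proof (intro set_eqI)
    fix e
    show "e \<in> {e. decide N e k s = t} \<longleftrightarrow> e \<in> (\<Union>m\<in>{m. from_nat m = t}. P m \<inter> (\<Inter>i\<in>{..<m}. - P i)) \<union> (if t = s then (\<Inter>m. - P m) else {})"
    proof (cases "\<exists>t. prefix s t \<and> forces (N k) e t")
      case False
      then have "e \<in> (\<Inter>m. - P m)"
        by (simp only: none_iff not_False_eq_True)
      then show ?thesis
        using False by (auto simp: decide_def)
    next
      case True
      define m0 where "m0 = (LEAST m. e \<in> P m)"
      from True have "\<exists>m. e \<in> P m"
        using none_iff[of e] by blast
      then have m0: "e \<in> P m0" "\<And>i. i < m0 \<Longrightarrow> e \<notin> P i"
        unfolding m0_def by (rule LeastI_ex, blast dest: not_less_Least)
      have "decide N e k s = from_nat m0"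
        using True by (simp add: decide_def m0_def P_def)
      moreover have "(\<exists>m. from_nat m = t \<and> e \<in> P m \<and> (\<forall>i<m. e \<notin> P i)) \<longleftrightarrow> from_nat m0 = t"
        using m0 by (metis linorder_neqE_nat)
      moreover have "e \<notin> (\<Inter>m. - P m)"
        using m0(1) by blast
      ultimately show ?thesis
        by (auto split: if_splits)
    qed
  qed
  also have "\<dots> \<in> Sigma0 (\<alpha> + 1)"
  proof -
    have "(\<Union>m\<in>{m. from_nat m = t}. P m \<inter> (\<Inter>i\<in>{..<m}. - P i)) \<in> Sigma0 (\<alpha> + 1)"
      using P none less by (intro Sigma0_UN Sigma0_Int one) (auto intro: Sigma0_mono[of \<alpha>])
    moreover have "(if t = s then (\<Inter>m. - P m) else {}) \<in> Sigma0 (\<alpha> + 1)"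
      using none by (simp add: clopen_in_Sigma0)
    ultimately show ?thesis
      by (intro Sigma0_Un one)
  qed
  finally show "{e. decide N e k s = t} \<in> Sigma0 (\<alpha> + 1)" .
qed

lemma Sigma0_measurable_jump:
  assumes \<alpha>: "1 \<le> \<alpha>" and forces: "\<And>k t. {e. forces (N k) e t} \<in> Sigma0 \<alpha>"
  shows "Sigma0_measurable (\<alpha> + 1) (jump N)"
proof -
  have one: "1 \<le> \<alpha> + 1"
    by (rule one_le_add_one)
  have dec: "discretely_measurable (\<alpha> + 1) (\<lambda>z. decide N (left z) k s)" for k s
    using discretely_measurable_continuous_compose[OF continuous_left
        discretely_measurable_decide[OF \<alpha> forces]] .
  have bit: "discretely_measurable (\<alpha> + 1) (\<lambda>z. g (right z i))" for i and g :: "bool \<Rightarrow> 'b"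
    using discretely_measurable_continuous_compose[OF continuous_right
        discretely_measurable_coordinate] .
  have "discretely_measurable (\<alpha> + 1) (\<lambda>z. retrace N (left z) (right z) k)" for k
  proof (induction k)
    case (Suc k)
    have "discretely_measurable (\<alpha> + 1) (\<lambda>z. decide N (left z) k (retrace N (left z) (right z) k))"
      using discretely_measurable_bind[OF one Suc dec] .
    from discretely_measurable_bind[OF one this bit[of "\<lambda>b. _ @ [b]"]] show ?case
      by (simp add: Let_def)
  qed (simp add: discretely_measurable_const)
  from discretely_measurable_bind[OF one this dec]
  have *: "discretely_measurable (\<alpha> + 1) (\<lambda>z. decide N (left z) k (retrace N (left z) (right z) k))" for k .
  have "discretely_measurable (\<alpha> + 1) (\<lambda>z. jump N z k)" for k
    unfolding jump_def using discretely_measurable_bind[OF one * bit[of "\<lambda>b. b"]] .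
  then show ?thesis
    by (rule Sigma0_measurableI[OF one])
qed

lemma build_step: "prefix (build N e y k) (build N e y (Suc k))"
  using prefix_decide by (simp add: prefix_prefix)

lemma build_mono: "j \<le> k \<Longrightarrow> prefix (build N e y j) (build N e y k)"
  by (induction k rule: dec_induct) (auto intro: prefix_order.trans build_step simp del: build.simps)

lemma length_build: "k \<le> length (build N e y k)"
proof (induction k)
  case (Suc k)
  then show ?case
    using prefix_length_le[OF prefix_decide, of "build N e y k" N e k] by simp
qed simp

text \<open>The bit at \<open>i\<close> is defined from stage \<open>Suc i\<close>, which is longer than \<open>i\<close>; every other stage that
  reaches \<open>i\<close> has the same bit there, since any two stages are comparable.\<close>

lemma generic_in_build: "generic N e y \<in> cylinder (build N e y k)"
proof -
  have "generic N e y i = build N e y k ! i" if "i < length (build N e y k)" for i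
  proof -
    have i: "i < length (build N e y (Suc i))"
      using length_build[of "Suc i" N e y] by linarith
    consider "prefix (build N e y k) (build N e y (Suc i))" | "prefix (build N e y (Suc i)) (build N e y k)"
      using build_mono[of k "Suc i" N e y] build_mono[of "Suc i" k N e y] by linarith
    then have "build N e y (Suc i) ! i = build N e y k ! i"
      using i that by cases (auto elim!: prefixE simp: nth_append simp del: build.simps)
    then show ?thesis
      by (simp only: generic_def)
  qed
  then show ?thesis
    by (simp add: cylinder_def)
qed

lemma generic_in_decide: "generic N e y \<in> cylinder (decide N e k (build N e y k))"
  using generic_in_build[of N e y "Suc k"] cylinder_antimono[of "decide N e k (build N e y k)" "build N e y (Suc k)"]
  by auto

lemma generic_at_decide: "generic N e y (length (decide N e k (build N e y k))) = y k"
  using generic_in_build[of N e y "Suc k"] by (simp add: cylinder_def nth_append)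

lemma retrace_generic: "retrace N e (generic N e y) k = build N e y k"
  by (induction k) (simp_all add: Let_def generic_at_decide)

lemma jump_generic: "jump N (pair e (generic N e y)) = y"
  by (rule ext) (simp add: jump_def retrace_generic generic_at_decide)

lemma build_agree: "agree k y y' \<Longrightarrow> build N e y k = build N e y' k"
  by (induction k) (auto simp: agree_def)

lemma continuous_generic: "continuous_on UNIV (generic N e)"
proof (rule continuous_cantorI)
  fix y n
  show "\<exists>m. \<forall>y'. agree m y y' \<longrightarrow> generic N e y' n = generic N e y n"
    using build_agree by (metis generic_def)
qed

text \<open>The map \<open>h\<close> is chosen before the sets \<open>F i\<close>.  This is possible because a point \<open>pair e x\<close> can
  carry a code \<open>e\<close> of the whole sequence: if \<open>W\<close> is universal and \<open>column e i\<close> codes \<open>F i\<close>, then on the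
  slice at \<open>e\<close> the set \<open>F i\<close> coincides with a set \<open>V i\<close> that does not depend on the sequence.
  Running the construction on all subcodes of the \<open>V i\<close> makes membership of \<open>\<phi> y\<close> in \<open>F i\<close> depend only
  on the finite stage at which \<open>V i\<close> is decided, hence on finitely many bits of \<open>y\<close>.\<close>

lemma jump_inversion:
  fixes \<alpha> :: countable_ordinal
  shows "\<exists>h. Sigma0_measurable (\<alpha> + 1) h \<and>
    (\<forall>F :: nat \<Rightarrow> cantor set. (\<forall>i. F i \<in> Sigma0 \<alpha>) \<longrightarrow>
      (\<exists>\<phi>. continuous_on UNIV \<phi> \<and> (\<forall>y. h (\<phi> y) = y) \<and> (\<forall>i. open (\<phi> -` F i) \<and> closed (\<phi> -` F i))))"
proof (cases "\<alpha> = 0")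
  case True
  then have "Sigma0_measurable (\<alpha> + 1) (\<lambda>x. x)"
    by (simp add: Sigma0_measurable_def Sigma0_one)
  moreover have "open ((\<lambda>x. x) -` F i) \<and> closed ((\<lambda>x. x) -` F i)"
    if "\<forall>i. F i \<in> Sigma0 \<alpha>" for F :: "nat \<Rightarrow> cantor set" and i
    using that True by (simp add: Sigma0_0)
  ultimately show ?thesis
    by (intro exI[of _ "\<lambda>x. x"] conjI allI impI) simp_all
next
  case False
  then have \<alpha>: "1 \<le> \<alpha>"
    by (simp add: countable_ordinal_one_le_iff)
  then obtain W where W: "W \<in> Sigma0 \<alpha>" "\<And>F. F \<in> Sigma0 \<alpha> \<Longrightarrow> \<exists>c. \<forall>x. x \<in> F \<longleftrightarrow> pair c x \<in> W"
    using universal_Sigma0_exists[of \<alpha>] by blast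
  have "(\<lambda>z. pair (column (left z) i) z) -` W \<in> Sigma0 \<alpha>" for i
    using W(1) by (intro Sigma0_continuous_vimage continuous_pair continuous_on_id
        continuous_on_compose2[OF continuous_column continuous_left]) auto
  then have "\<exists>c. has_rank c \<alpha> \<and> denote c = (\<lambda>z. pair (column (left z) i) z) -` W" for i
    by (rule Sigma0_has_code)
  then obtain v where v: "\<And>i. has_rank (v i) \<alpha>"
      "\<And>i. denote (v i) = (\<lambda>z. pair (column (left z) i) z) -` W"
    by metis
  \<comment> \<open>The truth lemma needs all subcodes to be decided, not just the codes of the \<open>V i\<close>.\<close>
  define C where "C = (\<Union>i. subcodes (v i))"
  have C: "C \<noteq> {}" "countable C"
    using self_in_subcodes countable_subcodes by (auto simp: C_def)
  define N where "N = from_nat_into C"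
  have range_N: "range N = C"
    unfolding N_def using C by (rule range_from_nat_into)
  have rank: "\<exists>\<beta>\<le>\<alpha>. has_rank c \<beta>" if "c \<in> C" for c
    using that v(1) has_rank_subcodes unfolding C_def by blast
  have "{e. forces (N k) e t} \<in> Sigma0 \<alpha>" for k t
    using rank[of "N k"] range_N forces_refutes_rank Sigma0_mono by blast
  then have "Sigma0_measurable (\<alpha> + 1) (jump N)"
    by (rule Sigma0_measurable_jump[OF \<alpha>])
  moreover have "\<exists>\<phi>. continuous_on UNIV \<phi> \<and> (\<forall>y. jump N (\<phi> y) = y) \<and>
      (\<forall>i. open (\<phi> -` F i) \<and> closed (\<phi> -` F i))"
    if F: "\<forall>i. F i \<in> Sigma0 \<alpha>" for F :: "nat \<Rightarrow> cantor set"
  proof -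
    have "\<exists>c. \<forall>x. x \<in> F i \<longleftrightarrow> pair c x \<in> W" for i
      by (rule W(2)) (simp add: F)
    then obtain c where c: "\<And>i x. x \<in> F i \<longleftrightarrow> pair (c i) x \<in> W"
      by metis
    obtain e where e: "\<And>i. column e i = c i"
      using exists_columns by blast
    define \<phi> where "\<phi> y = pair e (generic N e y)" for y
    have decided: "\<exists>t. generic N e y \<in> cylinder t \<and> (forces d e t \<or> refutes d e t)" if "d \<in> C" for d y
      using that range_N generic_in_decide decide_cases by blast
    have truth: "pair e (generic N e y) \<in> denote d \<longleftrightarrow>
        (\<exists>t. generic N e y \<in> cylinder t \<and> forces d e t)" if "d \<in> C" for d y
    proof (rule forcing_truth[OF decided _ _ that])
      show "f n \<in> C" if "Nor f \<in> C" for f n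
        using that subcodes_child unfolding C_def by blast
      show "\<exists>\<beta>. has_rank d \<beta>" if "d \<in> C" for d
        using rank[OF that] by blast
    qed
    have "open (\<phi> -` F i) \<and> closed (\<phi> -` F i)" for i
    proof -
      have "v i \<in> C"
        using self_in_subcodes by (auto simp: C_def)
      then obtain k where k: "N k = v i"
        using range_N by (metis imageE)
      have "\<phi> y \<in> F i \<longleftrightarrow> forces (v i) e (decide N e k (build N e y k))" for y
      proof -
        have "\<phi> y \<in> F i \<longleftrightarrow> \<phi> y \<in> denote (v i)"
          by (simp add: c v(2) \<phi>_def e)
        also have "\<dots> \<longleftrightarrow> (\<exists>t. generic N e y \<in> cylinder t \<and> forces (v i) e t)"
          unfolding \<phi>_def by (rule truth[OF \<open>v i \<in> C\<close>])
        also have "\<dots> \<longleftrightarrow> forces (v i) e (decide N e k (build N e y k))"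
          using generic_in_decide[of N e y k] decide_cases[of N k e "build N e y k"]
            forces_not_refutes unfolding k by blast
        finally show ?thesis .
      qed
      then show ?thesis
        unfolding clopen_cantor_iff using build_agree[of k _ _ N e] by (metis vimage_eq)
    qed
    moreover have "continuous_on UNIV \<phi>"
      unfolding \<phi>_def by (intro continuous_pair continuous_generic) simp
    moreover have "jump N (\<phi> y) = y" for y
      by (simp add: \<phi>_def jump_generic)
    ultimately show ?thesis
      by blast
  qed
  ultimately show ?thesis
    by blast
qed

section \<open>Continuous restrictions with a hard intersection\<close>

text \<open>A continuous map on a compact space is closed, so \<open>p\<close> is a quotient map onto its range, and
  the continuity of \<open>f\<close> along \<open>p\<close> passes down to the range.\<close>

lemma closed_continuous_restriction:
  fixes f p :: "cantor \<Rightarrow> cantor"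
  assumes p: "continuous_on UNIV p" and fp: "continuous_on UNIV (\<lambda>y. f (p y))"
  shows "closed (range p)" "continuous_on (range p) f"
proof -
  have closed: "closed (p ` B)" if "closed B" for B
  proof (rule compact_imp_closed_cantor)
    have "compact B"
      using compact_Int_closed[OF compact_UNIV_cantor that] by simp
    then show "compact (p ` B)"
      using compact_continuous_image continuous_on_subset[OF p] by blast
  qed
  then show rng: "closed (range p)"
    by simp
  show "continuous_on (range p) f"
    unfolding continuous_on_closed_vimage[OF rng]
  proof (intro allI impI)
    fix B :: "cantor set" assume "closed B"
    then have "closed (p ` ((\<lambda>y. f (p y)) -` B))"
      using fp by (intro closed closed_vimage)
    also have "p ` ((\<lambda>y. f (p y)) -` B) = f -` B \<inter> range p"
      by auto
    finally show "closed (f -` B \<inter> range p)" .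
  qed
qed

text \<open>With \<open>\<psi>\<close> reducing \<open>h -` T\<close> to \<open>A\<close>, pull back along \<open>\<psi>\<close> the countably many pieces of level \<open>\<alpha>\<close> into
  which \<open>f\<close> splits preimages of basic clopen sets, and let \<open>\<phi>\<close> make them clopen.  Then \<open>f\<close> is
  continuous along \<open>p = \<psi> \<circ> \<phi>\<close>, and \<open>p\<close> reduces \<open>T\<close> to \<open>A\<close> since \<open>\<phi>\<close> is a section of \<open>h\<close>.\<close>

lemma hard_piece_from_jump_inversion:
  fixes T :: "cantor set"
  assumes f: "Sigma0_measurable (\<alpha> + 1) f"
    and h: "\<And>F :: nat \<Rightarrow> cantor set. \<forall>i. F i \<in> Sigma0 \<alpha> \<Longrightarrow>
      \<exists>\<phi>. continuous_on UNIV \<phi> \<and> (\<forall>y. h (\<phi> y) = y) \<and> (\<forall>i. open (\<phi> -` F i) \<and> closed (\<phi> -` F i))"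
    and \<psi>: "continuous_on UNIV \<psi>" "\<And>x. x \<in> h -` T \<longleftrightarrow> \<psi> x \<in> A"
  shows "\<exists>C p. closed C \<and> continuous_on C f \<and> continuous_on UNIV p \<and> (\<forall>y. y \<in> T \<longleftrightarrow> p y \<in> A \<inter> C)"
proof -
  have one: "1 \<le> \<alpha> + 1"
    by (rule one_le_add_one)
  have "f -` cylinder s \<in> Sigma0 (\<alpha> + 1)" for s
    using f open_cylinder by (simp add: Sigma0_measurable_def)
  then have "\<forall>s. \<exists>T :: nat \<Rightarrow> cantor set. f -` cylinder s = (\<Union>n. T n) \<and> (\<forall>n. \<exists>\<beta><\<alpha> + 1. T n \<in> Pi0 \<beta>)"
    using one by (simp add: Sigma0_iff)
  then obtain P :: "bool list \<Rightarrow> nat \<Rightarrow> cantor set" where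
    P: "\<And>s. f -` cylinder s = (\<Union>n. P s n)" "\<And>s n. \<exists>\<beta><\<alpha> + 1. P s n \<in> Pi0 \<beta>"
    by metis
  define F where "F i = \<psi> -` (- case_prod P (from_nat i))" for i
  have "F i \<in> Sigma0 \<alpha>" for i
  proof -
    obtain s :: "bool list" and n :: nat where sn: "from_nat i = (s, n)"
      by force
    obtain \<beta> where "\<beta> \<le> \<alpha>" "P s n \<in> Pi0 \<beta>"
      using P(2) by (auto simp: less_add_one_countable_ordinal_iff)
    then have "- P s n \<in> Sigma0 \<alpha>"
      by (auto simp: Sigma0_uminus_iff intro: Pi0_mono)
    then show ?thesis
      unfolding F_def sn by (simp add: Sigma0_continuous_vimage[OF \<psi>(1)])
  qed
  with h obtain \<phi> where \<phi>: "continuous_on UNIV \<phi>" "\<And>y. h (\<phi> y) = y"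
      "\<And>i. closed (\<phi> -` F i)"
    by metis
  define p where "p y = \<psi> (\<phi> y)" for y
  have p: "continuous_on UNIV p"
    unfolding p_def using continuous_on_compose2[OF \<psi>(1) \<phi>(1)] by simp
  have "open ((\<lambda>y. f (p y)) -` U)" if "open U" for U
  proof -
    have "open (p -` P s n)" for s n
    proof -
      have "p -` P s n = - (\<phi> -` F (to_nat (s, n)))"
        by (auto simp: p_def F_def)
      with \<phi>(3) show ?thesis
        by (simp add: open_Compl)
    qed
    moreover have "(\<lambda>y. f (p y)) -` U = (\<Union>s\<in>{s. cylinder s \<subseteq> U}. \<Union>n. p -` P s n)"
    proof -
      have "(\<lambda>y. f (p y)) -` U = p -` (f -` (\<Union>s\<in>{s. cylinder s \<subseteq> U}. cylinder s))"
        using open_cantor_eq_UN_cylinder[OF that] by auto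
      then show ?thesis
        by (simp add: vimage_UN P(1))
    qed
    ultimately show ?thesis
      by (simp only:) (intro open_UN ballI)
  qed
  then have "continuous_on UNIV (\<lambda>y. f (p y))"
    by (simp add: continuous_on_open_vimage)
  note closed_continuous_restriction[OF p this]
  moreover have "y \<in> T \<longleftrightarrow> p y \<in> A \<inter> range p" for y
    using \<psi>(2)[of "\<phi> y"] \<phi>(2)[of y] by (simp add: p_def)
  ultimately show ?thesis
    using p by blast
qed

lemma hard_for_reduction:
  assumes "hard_for \<C> T" "continuous_on UNIV p" "\<And>y. y \<in> T \<longleftrightarrow> p y \<in> S"
  shows "hard_for \<C> S"
  unfolding hard_for_def
proof
  fix S' assume "S' \<in> \<C>"
  then obtain \<phi> :: "cantor \<Rightarrow> cantor" where "continuous_on UNIV \<phi>" "\<And>x. x \<in> S' \<longleftrightarrow> \<phi> x \<in> T"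
    using assms(1) unfolding hard_for_def by blast
  then show "\<exists>\<phi> :: cantor \<Rightarrow> cantor. continuous_on UNIV \<phi> \<and> (\<forall>x. x \<in> S' \<longleftrightarrow> \<phi> x \<in> S)"
    using assms(2,3) continuous_on_compose2[OF assms(2), of UNIV \<phi>]
    by (intro exI[of _ "\<lambda>x. p (\<phi> x)"]) auto
qed

text \<open>A universal set is complete: fixing the code in the pair is a continuous reduction.\<close>

lemma complete_Sigma0_exists:
  assumes "1 \<le> \<beta>"
  obtains T where "complete_for (Sigma0 \<beta>) T" "complete_for (Pi0 \<beta>) (- T)"
proof -
  obtain W where W: "W \<in> Sigma0 \<beta>" "\<And>F. F \<in> Sigma0 \<beta> \<Longrightarrow> \<exists>c. \<forall>x. x \<in> F \<longleftrightarrow> pair c x \<in> W"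
    using universal_Sigma0_exists[OF assms] by blast
  have "continuous_on UNIV (pair c)" for c
    using continuous_pair[of "\<lambda>_. c" "\<lambda>x. x"] by simp
  then have "hard_for (Sigma0 \<beta>) W"
    using W(2) unfolding hard_for_def by blast
  moreover from this have "hard_for (Pi0 \<beta>) (- W)"
    unfolding hard_for_def by (metis ComplD ComplI Sigma0_uminus_iff)
  ultimately show thesis
    using that W(1) by (simp add: complete_for_def Pi0_uminus_iff)
qed

theorem theorem5p1:
  fixes \<alpha> \<beta> :: countable_ordinal
    and f :: "cantor \<Rightarrow> cantor"
    and A :: "cantor set"
  assumes "Sigma0_measurable (\<alpha> + 1) f"
    and "complete_for (Sigma0 (\<alpha> + \<beta>)) A \<or> complete_for (Pi0 (\<alpha> + \<beta>)) A"
  shows "\<exists>C :: cantor set. closed C \<and> continuous_on C f \<and>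
           (hard_for (Sigma0 \<beta>) (A \<inter> C) \<or> hard_for (Pi0 \<beta>) (A \<inter> C))"
proof (cases "\<beta> = 0")
  case True
  have "(UNIV :: cantor set) \<in> Sigma0 (\<alpha> + \<beta>)" "(UNIV :: cantor set) \<in> Pi0 (\<alpha> + \<beta>)"
    by (simp_all add: clopen_in_Sigma0 clopen_in_Pi0)
  then obtain a where "a \<in> A"
    using assms(2) unfolding complete_for_def hard_for_def by blast
  obtain b where "b \<noteq> a"
    by (rule that[of "\<lambda>n. \<not> a n"]) (auto simp: fun_eq_iff)
  \<comment> \<open>At level \<open>0\<close> hardness only asks for a point inside and a point outside, so \<open>C = {a}\<close> works.\<close>
  have "hard_for (Sigma0 0) {a}"
    unfolding hard_for_def
  proof
    fix S assume "S \<in> Sigma0 0"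
    then have "open S" "open (- S)"
      by (simp_all add: Sigma0_0 open_Compl)
    have "continuous_on UNIV (\<lambda>x. if x \<in> S then a else b)"
      unfolding continuous_on_open_vimage[OF open_UNIV]
    proof (intro allI impI)
      fix B :: "cantor set"
      have "(\<lambda>x. if x \<in> S then a else b) -` B \<inter> UNIV =
          (if a \<in> B then S else {}) \<union> (if b \<in> B then - S else {})"
        by auto
      with \<open>open S\<close> \<open>open (- S)\<close> show "open ((\<lambda>x. if x \<in> S then a else b) -` B \<inter> UNIV)"
        by (simp add: open_Un)
    qed
    moreover have "x \<in> S \<longleftrightarrow> (if x \<in> S then a else b) \<in> {a}" for x
      using \<open>b \<noteq> a\<close> by simp
    ultimately show "\<exists>\<phi>. continuous_on UNIV \<phi> \<and> (\<forall>x. x \<in> S \<longleftrightarrow> \<phi> x \<in> {a})"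
      by blast
  qed
  moreover have "A \<inter> {a} = {a}"
    using \<open>a \<in> A\<close> by auto
  moreover have "closed {a}"
    by (rule compact_imp_closed_cantor) simp
  ultimately show ?thesis
    using True by (intro exI[of _ "{a}"]) simp
next
  case False
  then have \<beta>: "1 \<le> \<beta>"
    by (simp add: countable_ordinal_one_le_iff)
  obtain T where T: "complete_for (Sigma0 \<beta>) T" "complete_for (Pi0 \<beta>) (- T)"
    using complete_Sigma0_exists[OF \<beta>] .
  obtain h where h: "Sigma0_measurable (\<alpha> + 1) h"
    "\<And>F :: nat \<Rightarrow> cantor set. \<forall>i. F i \<in> Sigma0 \<alpha> \<Longrightarrow> \<exists>\<phi>. continuous_on UNIV \<phi> \<and>
       (\<forall>y. h (\<phi> y) = y) \<and> (\<forall>i. open (\<phi> -` F i) \<and> closed (\<phi> -` F i))"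
    using jump_inversion[of \<alpha>] by blast
  have S: "h -` T \<in> Sigma0 (\<alpha> + \<beta>)"
    using T(1) by (intro Sigma0_measurable_vimage h(1) \<beta>) (simp add: complete_for_def)
  then have P: "h -` (- T) \<in> Pi0 (\<alpha> + \<beta>)"
    by (simp add: vimage_Compl Pi0_uminus_iff)
  have reduce: "\<exists>C. closed C \<and> continuous_on C f \<and> hard_for \<C> (A \<inter> C)"
    if "hard_for \<D> A" "h -` X \<in> \<D>" "hard_for \<C> X" for \<C> \<D> X
  proof -
    obtain \<psi> :: "cantor \<Rightarrow> cantor" where \<psi>: "continuous_on UNIV \<psi>" "\<And>x. x \<in> h -` X \<longleftrightarrow> \<psi> x \<in> A"
      using \<open>hard_for \<D> A\<close> \<open>h -` X \<in> \<D>\<close> unfolding hard_for_def by blast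
    from hard_piece_from_jump_inversion[OF assms(1) h(2) \<psi>] obtain C p where
      "closed C" "continuous_on C f" "continuous_on UNIV p" "\<And>y. y \<in> X \<longleftrightarrow> p y \<in> A \<inter> C"
      by blast
    then show ?thesis
      using hard_for_reduction[OF \<open>hard_for \<C> X\<close>] by blast
  qed
  from assms(2) show ?thesis
  proof
    assume "complete_for (Sigma0 (\<alpha> + \<beta>)) A"
    then show ?thesis
      using reduce[OF _ S, of "Sigma0 \<beta>"] T(1) by (auto simp: complete_for_def)
  next
    assume "complete_for (Pi0 (\<alpha> + \<beta>)) A"
    then show ?thesis
      using reduce[OF _ P, of "Pi0 \<beta>"] T(2) by (auto simp: complete_for_def)
  qed
qed

end
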